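(* Let $r\ge 1$ and $(k_1,\dots,k_r)\in(\mathbb{Z}^+)^r$. (i) $H_s^\star(k_1,\dots,k_r)$ is well-defined (i.e. the limits in its inductive definition exist) for every $s\in\mathbb{C}$ with $\mathrm{Re}(s)>0$, and $s\mapsto H_s^\star(k_1,\dots,k_r)$ is analytic on $\{\mathrm{Re}(s)>0\}$. Moreover, for every $n\in\mathbb{Z}^+$ its value at $s=n$ is the finite sum $$H_s^\star(k_1,\dots,k_r)\Big|_{s=n}=\sum_{n\ge m_1\ge\cdots\ge m_r\ge1}\frac{1}{m_1^{k_1}\cdots m_r^{k_r}}.$$ (ii) Put $X_j=x_1x_2\cdots x_{k_1+\cdots+k_j}$ for $1\le j\le r$. Then for all $s$ with $\mathrm{Re}(s)>0$, $$H_s^\star(k_1,\dots,k_r)=\int_{(0,1)^{k_1+\cdots+k_r}}[1,X_1,\dots,X_r]\,t^{s+r-1}\,dx_1\cdots dx_{k_1+\cdots+k_r},$$ where $[1,X_1,\dots,X_r]t^{s+r-1}$ is the divided difference of the function $t\mapsto t^{s+r-1}$ relative to the points $1,X_1,\dots,X_r$.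
   Context: $\mathbb{Z}^+=\{1,2,\dots\}$; for $t>0$ and $s\in\mathbb{C}$, $t^s=e^{s\log t}$. Finite sums: for $M\in\mathbb{Z}^+$, $H_M^\star(k_1,\dots,k_r)=\sum_{M\ge m_1\ge\cdots\ge m_r\ge1}\frac{1}{m_1^{k_1}\cdots m_r^{k_r}}$; for $\mathrm{Re}(s)>0$, $G_M^\star(s;k_1,\dots,k_r)=\sum_{M\ge m_1\ge\cdots\ge m_r\ge1}\frac{1}{(m_1+s)^{k_1}\cdots(m_r+s)^{k_r}}$. Inductive definition for complex $s$ with $\mathrm{Re}(s)>0$: $H_s^\star(\varnothing)=1$ and, for $r\ge1$, $$H_s^\star(k_1,\dots,k_r)=\lim_{M\to+\infty}\Big(H_M^\star(k_1,\dots,k_r)-\sum_{j=1}^rG_M^\star(s;k_1,\dots,k_j)\,H_s^\star(k_{j+1},\dots,k_r)\Big),$$ where $M$ runs over positive integers, $H_M^\star$ on the right is the finite sum above, and the $j=r$ term uses $H_s^\star(\varnothing)=1$. Divided difference: for pairwise distinct points $y_0,\dots,y_m$, $[y_0,\dots,y_m]f=\sum_{i=0}^m\frac{f(y_i)}{\prod_{0\le j\le m,\,j\ne i}(y_i-y_j)}$. (In the integral the points $1>X_1>\cdots>X_r>0$ are pairwise distinct.) *)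

theory Defs
  imports "HOL-Analysis.Analysis"
begin

text \<open>An index tuple $(k_1,\dots,k_r)$ is a \<^typ>\<open>nat list\<close>, with $k_j$ at list position $j-1$.\<close>

definition star_tuples :: "nat \<Rightarrow> nat \<Rightarrow> nat list set" where
  "star_tuples M r = {ms. length ms = r \<and> sorted_wrt (\<ge>) ms \<and> set ms \<subseteq> {1..M}}"

definition H_fin :: "nat \<Rightarrow> nat list \<Rightarrow> complex" where
  "H_fin M ks =
     (\<Sum>ms\<in>star_tuples M (length ks). 1 / (\<Prod>j<length ks. of_nat (ms ! j) ^ (ks ! j)))"

definition G_fin :: "nat \<Rightarrow> complex \<Rightarrow> nat list \<Rightarrow> complex" where
  "G_fin M s ks =
     (\<Sum>ms\<in>star_tuples M (length ks). 1 / (\<Prod>j<length ks. (of_nat (ms ! j) + s) ^ (ks ! j)))"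

text \<open>\<^const>\<open>lim\<close> is an arbitrary value if the sequence diverges, so the definition is meaningful
  only together with convergence of \<open>H_star_seq\<close> (below) for the list and all its nonempty suffixes.
  The sequence also has a term for $M = 0$, which does not affect convergence or the limit.\<close>

function H_star :: "complex \<Rightarrow> nat list \<Rightarrow> complex" where
  "H_star s ks =
     (if ks = [] then 1
      else lim (\<lambda>M. H_fin M ks
                     - (\<Sum>j=1..length ks. G_fin M s (take j ks) * H_star s (drop j ks))))"
  by pat_completeness auto
termination
  by (relation "Wellfounded.measure (\<lambda>(s, ks). length ks)") auto

declare H_star.simps [simp del]

definition H_star_seq :: "complex \<Rightarrow> nat list \<Rightarrow> nat \<Rightarrow> complex" where
  "H_star_seq s ks M =
     H_fin M ks - (\<Sum>j=1..length ks. G_fin M s (take j ks) * H_star s (drop j ks))"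

lemma H_star_Nil: "H_star s [] = 1"
  by (simp add: H_star.simps)

lemma H_star_eq_lim: "ks \<noteq> [] \<Longrightarrow> H_star s ks = lim (H_star_seq s ks)"
  unfolding H_star_seq_def [abs_def] by (subst H_star.simps) simp

text \<open>Divided difference of \<open>f\<close> at the pairwise distinct points listed in \<open>ys\<close>.\<close>

definition divided_difference :: "real list \<Rightarrow> (real \<Rightarrow> complex) \<Rightarrow> complex" where
  "divided_difference ys f =
     (\<Sum>i<length ys. f (ys ! i) / of_real (\<Prod>j\<in>{..<length ys} - {i}. ys ! i - ys ! j))"

text \<open>$X_j = x_1 x_2 \cdots x_{k_1+\cdots+k_j}$\<close>

definition X :: "nat list \<Rightarrow> (nat \<Rightarrow> real) \<Rightarrow> nat \<Rightarrow> real" where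
  "X ks x j = (\<Prod>i=1..sum_list (take j ks). x i)"

definition unit_cube :: "nat \<Rightarrow> (nat \<Rightarrow> real) set" where
  "unit_cube d = (\<Pi>\<^sub>E i\<in>{1..d}. {0<..<1})"

abbreviation lborel_pow :: "nat \<Rightarrow> (nat \<Rightarrow> real) measure" where
  "lborel_pow d \<equiv> (\<Pi>\<^sub>M i\<in>{1..d}. lborel)"

definition H_integrand :: "complex \<Rightarrow> nat list \<Rightarrow> (nat \<Rightarrow> real) \<Rightarrow> complex" where
  "H_integrand s ks x =
     divided_difference (1 # map (X ks x) [1..<length ks + 1])
       (\<lambda>t. of_real t powr (s + of_nat (length ks) - 1))"

end

theory Submission
  imports Defs "HOL-Complex_Analysis.Cauchy_Integral_Formula" "HOL-Real_Asymp.Real_Asymp"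
begin

text \<open>The integral in (ii) is taken as the primary object and called \<open>star_integral\<close>; everything else
is read off from one difference equation for it. Write $F_s(k_1,\dots,k_r)$ for the integral.
The divided difference of $(t-1)\,t^{s+r-1}$ at $1,X_1,\dots,X_r$ loses the node $1$, and the remaining
nodes $X_1,\dots,X_r$ are the multiples by $X_1$ of a configuration of the same kind of length $r-1$.
Since $X_1^s$ is integrated over the first $k_1$ variables to $(s+1)^{-k_1}$, this gives
\[ F_{s+1}(k_1,\dots,k_r) = F_s(k_1,\dots,k_r) + (s+1)^{-k_1} F_{s+1}(k_2,\dots,k_r) \]
(\<open>star_integral_step\<close>, from the pointwise \<open>star_kernel_Suc\<close>). The finite sums $G_M^\star$ satisfy the
same recursion in $M$, so that iteration yields
\[ F_{s+M}(k_1,\dots,k_r) = \sum_{j=0}^r G_M^\star(s;k_1,\dots,k_j)\, F_s(k_{j+1},\dots,k_r) \]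
(\<open>star_integral_expansion\<close>). At $s=0$ the function $t^{r-1}$ has degree less than $r$, hence $F_0=0$ for
$r\ge1$, and the expansion becomes $F_M = H_M^\star$, which is the claim about positive integers.
For $\mathrm{Re}(s)>0$ the expansion says that the sequence whose limit defines $H_s^\star$ equals
$F_s-(F_{s+M}-F_M)$. It therefore remains to show that $F_{s+M}-F_M\to0$, and in fact
locally uniformly in $s$, because then $F_s$ is also a locally uniform limit of holomorphic functions.

This decay, together with absolute convergence of the integral, is the analytic core
(\<open>nn_integral_star_kernel_shift\<close>): the integral of the absolute value of the difference of the two integrands is
at most $C\,|s|/\sqrt{M+1}$. Pointwise the difference of the integrands tends to $0$ as $M\to\infty$, since every node
other than $1$ lies below $1$; so it is bounded by the sum of its later increments. By the difference
equation each increment is $X_1^{s+m}$ times a difference for $r-1$, plus $X_1^{s+m}-X_1^m$ times an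
integrand for $r-1$ at an integer. By induction on $r$ and because the integrals of the absolute values
at integers $m$ are $O(\sqrt m)$, both contribute $O(|s|\,m^{-3/2})$, whose tails are $O(|s|\,M^{-1/2})$.

For the induction on $r$ the variables are grouped into arbitrary disjoint blocks of indices, one for
each $k_j$, so that removing the first block leaves an instance of the same problem with no
renumbering of variables.\<close>

section \<open>Divided differences over a set of nodes\<close>

text \<open>Indexing by the set of nodes instead of a list makes removing an arbitrary node a mere set difference.\<close>

definition divdiff :: "real set \<Rightarrow> (real \<Rightarrow> complex) \<Rightarrow> complex" where
  "divdiff S f = (\<Sum>y\<in>S. f y / of_real (\<Prod>u\<in>S - {y}. y - u))"

lemma divided_difference_eq_divdiff:
  assumes "distinct ys"
  shows "divided_difference ys f = divdiff (set ys) f"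
proof -
  have bij: "bij_betw (\<lambda>i. ys ! i) {..<length ys} (set ys)"
    using assms by (intro bij_betw_nth) auto
  have inj: "inj_on (\<lambda>i. ys ! i) {..<length ys}" and im: "(\<lambda>i. ys ! i) ` {..<length ys} = set ys"
    using bij by (auto simp: bij_betw_def)
  have "(\<Prod>u\<in>set ys - {ys ! i}. ys ! i - u) = (\<Prod>j\<in>{..<length ys} - {i}. ys ! i - ys ! j)"
    if "i < length ys" for i
  proof -
    have "set ys - {ys ! i} = (\<lambda>i. ys ! i) ` ({..<length ys} - {i})"
      using that inj_on_image_set_diff[OF inj, of "{..<length ys}" "{i}"] by (simp add: im)
    then show ?thesis
      using inj by (simp add: prod.reindex inj_on_diff)
  qed
  then have "(\<Sum>y\<in>set ys. f y / of_real (\<Prod>u\<in>set ys - {y}. y - u)) = divided_difference ys f"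
    unfolding divided_difference_def by (subst sum.reindex_bij_betw[OF bij, symmetric]) simp
  then show ?thesis by (simp add: divdiff_def)
qed

lemma divdiff_add: "divdiff S (\<lambda>t. f t + g t) = divdiff S f + divdiff S g"
  by (simp add: divdiff_def add_divide_distrib sum.distrib)

lemma divdiff_cmult: "divdiff S (\<lambda>t. c * f t) = c * divdiff S f"
  by (simp add: divdiff_def sum_distrib_left)

lemma divdiff_cong: "(\<And>t. t \<in> S \<Longrightarrow> f t = g t) \<Longrightarrow> divdiff S f = divdiff S g"
  by (simp add: divdiff_def)

text \<open>The term of the node $a$ vanishes, and in each other term the factor $t-a$ cancels one factor of the denominator.\<close>

lemma divdiff_cancel_node:
  assumes "finite S" "a \<in> S"
  shows "divdiff S (\<lambda>t. (of_real t - of_real a) * f t) = divdiff (S - {a}) f"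
proof -
  have "divdiff S (\<lambda>t. (of_real t - of_real a) * f t) =
     (\<Sum>y\<in>S - {a}. (of_real y - of_real a) * f y / of_real (\<Prod>u\<in>S - {y}. y - u))"
    unfolding divdiff_def using assms by (simp add: sum.remove)
  also have "\<dots> = divdiff (S - {a}) f"
    unfolding divdiff_def
  proof (rule sum.cong[OF refl])
    fix y assume y: "y \<in> S - {a}"
    have "S - {y} - {a} = S - {a} - {y}" by auto
    then have "(\<Prod>u\<in>S - {y}. y - u) = (y - a) * (\<Prod>u\<in>S - {a} - {y}. y - u)"
      using assms y by (subst prod.remove[of _ a]) auto
    moreover have "(of_real y - of_real a :: complex) \<noteq> 0" using y by auto
    ultimately show "(of_real y - of_real a) * f y / of_real (\<Prod>u\<in>S - {y}. y - u) =
        f y / complex_of_real (\<Prod>u\<in>S - {a} - {y}. y - u)" by simp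
  qed
  finally show ?thesis .
qed

text \<open>Cancelling the node $a$ and cancelling the node $b$ express the divided difference of $t$ in two ways.
Comparing them gives the usual recursion, by which $(b-a)$ times the divided difference over $S$
is the difference of those over $S-\{a\}$ and $S-\{b\}$; these agree by induction.\<close>

lemma divdiff_const_eq_0:
  assumes "finite S" "2 \<le> card S"
  shows "divdiff S (\<lambda>_. 1) = 0"
  using assms
proof (induction "card S" arbitrary: S rule: less_induct)
  case less
  then obtain a b where ab: "a \<in> S" "b \<in> S" "a \<noteq> b"
    by (metis One_nat_def Suc_1 card_le_Suc0_iff_eq not_less_eq_eq)
  have eq: "divdiff (S - {a}) (\<lambda>_. 1) = divdiff (S - {b}) (\<lambda>_. 1)"
  proof (cases "card S = 2")
    case True
    then have "S = {a, b}"
      using ab less.prems by (metis card_2_iff doubleton_eq_iff empty_iff insertE)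
    then have "S - {a} = {b}" "S - {b} = {a}" using ab by auto
    then show ?thesis by (simp add: divdiff_def)
  next
    case False
    then have "divdiff (S - {c}) (\<lambda>_. 1) = 0" if "c \<in> S" for c
      using less that by (intro less.hyps) auto
    then show ?thesis using ab by simp
  qed
  have *: "divdiff S (\<lambda>t. of_real t) = divdiff (S - {c}) (\<lambda>_. 1) + of_real c * divdiff S (\<lambda>_. 1)" if "c \<in> S" for c
    using divdiff_cancel_node[OF less.prems(1) that, of "\<lambda>_. 1"]
      divdiff_add[of S "\<lambda>t. of_real t - of_real c" "\<lambda>_. of_real c"] divdiff_cmult[of S "of_real c" "\<lambda>_. 1"]
    by simp
  have "(of_real b - of_real a) * divdiff S (\<lambda>_. 1) = 0"
    using *[OF ab(1)] *[OF ab(2)] eq by (simp add: algebra_simps)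
  then show ?case using ab by simp
qed

text \<open>Each cancelled node lowers the degree by one, down to a constant with at least two nodes left.\<close>

lemma divdiff_power_eq_0:
  assumes "finite S" "Suc n < card S"
  shows "divdiff S (\<lambda>t. of_real t ^ n) = 0"
  using assms
proof (induction n arbitrary: S)
  case 0
  then show ?case by (simp add: divdiff_const_eq_0)
next
  case (Suc n)
  then obtain a where a: "a \<in> S" by fastforce
  have "divdiff S (\<lambda>t. of_real t ^ Suc n) =
      divdiff S (\<lambda>t. (of_real t - of_real a) * of_real t ^ n) + of_real a * divdiff S (\<lambda>t. of_real t ^ n)"
    unfolding divdiff_cmult[symmetric] divdiff_add[symmetric]
    by (rule divdiff_cong) (simp add: algebra_simps)
  also have "\<dots> = divdiff (S - {a}) (\<lambda>t. of_real t ^ n) + of_real a * divdiff S (\<lambda>t. of_real t ^ n)"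
    using Suc.prems a by (simp add: divdiff_cancel_node)
  also have "\<dots> = 0" using Suc a by simp
  finally show ?case .
qed

lemma divdiff_scale:
  assumes "z \<noteq> 0" "finite S"
  shows "divdiff ((*) z ` S) f = divdiff S (\<lambda>t. f (z * t)) / of_real z ^ (card S - 1)"
proof -
  have inj: "inj ((*) z)" using assms by (simp add: inj_on_def)
  have eq: "(\<Prod>u\<in>(*) z ` S - {z * y}. z * y - u) = z ^ (card S - 1) * (\<Prod>u\<in>S - {y}. y - u)"
    if "y \<in> S" for y
  proof -
    have "(*) z ` S - {z * y} = (*) z ` (S - {y})" using assms by auto
    then have "(\<Prod>u\<in>(*) z ` S - {z * y}. z * y - u) = (\<Prod>u\<in>S - {y}. z * (y - u))"
      using inj_on_subset[OF inj] by (simp add: prod.reindex right_diff_distrib)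
    then show ?thesis using assms that by (simp add: prod.distrib)
  qed
  have "divdiff ((*) z ` S) f =
      (\<Sum>y\<in>S. f (z * y) / of_real (\<Prod>u\<in>(*) z ` S - {z * y}. z * y - u))"
    unfolding divdiff_def using inj_on_subset[OF inj subset_UNIV] by (subst sum.reindex) simp_all
  also have "\<dots> = (\<Sum>y\<in>S. f (z * y) / of_real (\<Prod>u\<in>S - {y}. y - u) / of_real z ^ (card S - 1))"
    by (intro sum.cong refl) (subst eq, simp_all add: mult.commute del: of_real_prod)
  finally show ?thesis by (simp only: divdiff_def sum_divide_distrib)
qed

section \<open>The integrand as a function of the block products\<close>

text \<open>With $z_j$ the product of the variables in the $j$-th block, the nodes are the partial products $1, z_1, z_1z_2, \dots$.
The recursion exhibits all nodes but the first as a dilation of a shorter configuration.\<close>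

primrec nodes :: "real list \<Rightarrow> real list" where
  "nodes [] = [1]"
| "nodes (z # zs) = 1 # map ((*) z) (nodes zs)"

definition star_kernel :: "complex \<Rightarrow> real list \<Rightarrow> complex" where
  "star_kernel s zs = divided_difference (nodes zs) (\<lambda>t. of_real t powr (s + of_nat (length zs) - 1))"

lemma length_nodes [simp]: "length (nodes zs) = Suc (length zs)"
  by (induction zs) auto

lemma nodes_bounds:
  assumes "set zs \<subseteq> {0<..<1}" "t \<in> set (nodes zs)"
  shows "0 < t" "t \<le> 1"
  using assms
proof (induction zs arbitrary: t)
  case (Cons z zs)
  { case 1 then show ?case using Cons.IH by auto }
  { case 2 then show ?case using Cons.IH(2) Cons.IH(1)
      by (auto intro!: mult_le_one simp: less_imp_le) }
qed auto

lemma nodes_less_1: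
  assumes "set (z # zs) \<subseteq> {0<..<1}" "t \<in> set (nodes zs)"
  shows "z * t < 1"
  using nodes_bounds[of zs t] assms mult_less_le_imp_less[of z 1 t 1] by auto

lemma distinct_nodes:
  assumes "set zs \<subseteq> {0<..<1}"
  shows "distinct (nodes zs)"
  using assms
proof (induction zs)
  case (Cons z zs)
  then show ?case
    using nodes_less_1[of z zs] by (fastforce simp: distinct_map inj_on_def)
qed auto

lemma card_nodes: "set zs \<subseteq> {0<..<1} \<Longrightarrow> card (set (nodes zs)) = Suc (length zs)"
  using distinct_nodes distinct_card by fastforce

lemma star_kernel_eq_divdiff:
  "set zs \<subseteq> {0<..<1} \<Longrightarrow>
    star_kernel s zs = divdiff (set (nodes zs)) (\<lambda>t. of_real t powr (s + of_nat (length zs) - 1))"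
  by (simp add: star_kernel_def divided_difference_eq_divdiff distinct_nodes)

lemma star_kernel_Nil [simp]: "star_kernel s [] = 1"
  by (simp add: star_kernel_def divided_difference_def)

lemma star_kernel_0:
  assumes "set zs \<subseteq> {0<..<1}" "zs \<noteq> []"
  shows "star_kernel 0 zs = 0"
proof -
  obtain n where n: "length zs = Suc n" using assms by (cases zs) auto
  have "star_kernel 0 zs = divdiff (set (nodes zs)) (\<lambda>t. of_real t ^ n)"
    unfolding star_kernel_eq_divdiff[OF assms(1)] using nodes_bounds[OF assms(1)]
    by (intro divdiff_cong) (force simp: n)
  also have "\<dots> = 0" using card_nodes[OF assms(1)] by (simp add: divdiff_power_eq_0 n)
  finally show ?thesis .
qed

text \<open>The difference $t^{s+r}-t^{s+r-1}=(t-1)\,t^{s+r-1}$ cancels the node $1$. The other nodes are a dilation by $z$,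
and homogeneity pulls out $z^{s+r-1}/z^{r-1}=z^s$.\<close>

lemma star_kernel_Suc:
  assumes "set (z # zs) \<subseteq> {0<..<1}"
  shows "star_kernel (s + 1) (z # zs) = star_kernel s (z # zs) + of_real z powr s * star_kernel (s + 1) zs"
proof -
  let ?r = "of_nat (length zs) :: complex" and ?S = "set (nodes (z # zs))" and ?T = "set (nodes zs)"
  have z: "0 < z" "z < 1" and zs: "set zs \<subseteq> {0<..<1}" using assms by auto
  have pos: "t > 0" if "t \<in> ?S" for t using nodes_bounds(1)[OF assms that] .
  have pos': "t > 0" if "t \<in> ?T" for t using nodes_bounds[OF zs that] by simp
  have S1: "?S - {1} = (*) z ` ?T"
    using nodes_less_1[OF assms] by fastforce
  have "star_kernel (s + 1) (z # zs) = divdiff ?S (\<lambda>t. of_real t powr (s + ?r) +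
      (of_real t - of_real 1) * of_real t powr (s + ?r))"
    unfolding star_kernel_eq_divdiff[OF assms]
  proof (rule divdiff_cong)
    fix t assume "t \<in> ?S"
    then have "complex_of_real t powr (s + 1 + ?r) = of_real t * of_real t powr (s + ?r)"
      using pos[of t] by (simp add: powr_add)
    then show "complex_of_real t powr (s + 1 + of_nat (length (z # zs)) - 1) =
         of_real t powr (s + ?r) + (of_real t - of_real 1) * of_real t powr (s + ?r)"
      by (simp add: algebra_simps)
  qed
  also have "\<dots> = star_kernel s (z # zs) + divdiff (?S - {1}) (\<lambda>t. of_real t powr (s + ?r))"
    unfolding star_kernel_eq_divdiff[OF assms] divdiff_add by (subst divdiff_cancel_node) simp_all
  also have "divdiff (?S - {1}) (\<lambda>t. of_real t powr (s + ?r)) =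
      divdiff ?T (\<lambda>t. of_real (z * t) powr (s + ?r)) / of_real z ^ length zs"
    using z by (simp only: S1, subst divdiff_scale) (simp_all add: card_nodes[OF zs])
  also have "divdiff ?T (\<lambda>t. of_real (z * t) powr (s + ?r)) =
      divdiff ?T (\<lambda>t. of_real z powr (s + ?r) * of_real t powr (s + ?r))"
    using z pos' by (intro divdiff_cong) (simp add: powr_times_real less_imp_le)
  also have "\<dots> = of_real z powr (s + ?r) * star_kernel (s + 1) zs"
    unfolding star_kernel_eq_divdiff[OF zs] divdiff_cmult by (simp add: algebra_simps)
  also have "of_real z powr (s + ?r) = of_real z powr s * of_real z ^ length zs"
    using z by (simp add: powr_add)
  finally show ?thesis using z by simp
qed

lemma powr_shift_tendsto_0:
  assumes "0 < t" "t < 1"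
  shows "(\<lambda>M. complex_of_real t powr (s + of_nat M + a)) \<longlonglongrightarrow> 0"
proof -
  have "(\<lambda>M. of_real t powr (s + a) * complex_of_real t ^ M) \<longlonglongrightarrow> of_real t powr (s + a) * 0"
    using assms by (intro tendsto_mult tendsto_const LIMSEQ_power_zero) auto
  moreover have "of_real t powr (s + of_nat M + a) = of_real t powr (s + a) * complex_of_real t ^ M" for M
    using assms by (simp add: powr_add algebra_simps)
  ultimately show ?thesis by simp
qed

text \<open>Only the node $1$ carries a term that does not decay as $M$ grows, and that term is the same for both exponents.\<close>

lemma star_kernel_diff_tendsto_0:
  assumes "set zs \<subseteq> {0<..<1}"
  shows "(\<lambda>M. star_kernel (s + of_nat M) zs - star_kernel (of_nat M) zs) \<longlonglongrightarrow> 0"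
proof -
  let ?p = "\<lambda>s M t. complex_of_real t powr (s + of_nat M + (of_nat (length zs) - 1))"
  let ?q = "\<lambda>t. complex_of_real (\<Prod>u\<in>set (nodes zs) - {t}. t - u)"
  have "(\<lambda>M. (?p s M t - ?p 0 M t) / ?q t) \<longlonglongrightarrow> 0" if "t \<in> set (nodes zs)" for t
  proof (cases "t = 1")
    case False
    then have "0 < t" "t < 1" using nodes_bounds[OF assms that] by auto
    then have "(\<lambda>M. (?p s M t - ?p 0 M t) / ?q t) \<longlonglongrightarrow> (0 - 0) / ?q t"
      by (intro tendsto_divide tendsto_diff tendsto_const powr_shift_tendsto_0) auto
    then show ?thesis by simp
  qed auto
  then have "(\<lambda>M. \<Sum>t\<in>set (nodes zs). (?p s M t - ?p 0 M t) / ?q t) \<longlonglongrightarrow> 0"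
    by (intro tendsto_null_sum)
  then show ?thesis
    unfolding star_kernel_eq_divdiff[OF assms] divdiff_def sum_subtractf[symmetric] diff_divide_distrib
    by (simp add: algebra_simps)
qed

section \<open>Product measures on the open unit cube\<close>

text \<open>Building the restriction to $(0,1)$ into the measure of each coordinate keeps indicator functions out of
every application of Fubini's theorem.\<close>

definition unit_lborel :: "real measure" where
  "unit_lborel = density lborel (indicator {0<..<1})"

abbreviation cube_measure :: "nat set \<Rightarrow> (nat \<Rightarrow> real) measure" where
  "cube_measure I \<equiv> \<Pi>\<^sub>M i\<in>I. unit_lborel"

lemma sets_unit_lborel [measurable_cong]: "sets unit_lborel = sets borel"
  by (simp add: unit_lborel_def)

lemma space_unit_lborel [simp]: "space unit_lborel = UNIV"
  by (simp add: unit_lborel_def)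

interpretation U: product_sigma_finite "\<lambda>i::nat. unit_lborel"
proof (rule product_sigma_finite.intro)
  interpret finite_measure unit_lborel
    by standard (simp add: unit_lborel_def emeasure_density)
  show "sigma_finite_measure unit_lborel" by (rule sigma_finite_measure_axioms)
qed

lemma cube_measure_eq_density:
  assumes "finite I"
  shows "cube_measure I = density (\<Pi>\<^sub>M i\<in>I. lborel) (indicator (\<Pi>\<^sub>E i\<in>I. {0<..<1}))"
proof (rule U.PiM_eqI[OF assms, symmetric])
  interpret L: product_sigma_finite "\<lambda>i::nat. lborel :: real measure" ..
  let ?L = "\<Pi>\<^sub>M i\<in>I. (lborel :: real measure)"
  have [measurable]: "(\<Pi>\<^sub>E i\<in>I. {0<..<1}) \<in> sets ?L"
    using assms by (intro sets_PiM_I_finite) auto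
  show sets: "sets (density ?L (indicator (\<Pi>\<^sub>E i\<in>I. {0<..<1}))) = sets (cube_measure I)"
    by (simp cong: sets_PiM_cong add: sets_unit_lborel)
  fix A :: "nat \<Rightarrow> real set" assume A: "\<And>i. i \<in> I \<Longrightarrow> A i \<in> sets unit_lborel"
  then have [measurable]: "Pi\<^sub>E I A \<in> sets ?L"
    using assms by (intro sets_PiM_I_finite) (auto simp: sets_unit_lborel)
  have "emeasure (density ?L (indicator (\<Pi>\<^sub>E i\<in>I. {0<..<1}))) (Pi\<^sub>E I A) =
      (\<integral>\<^sup>+ x. indicator (\<Pi>\<^sub>E i\<in>I. {0<..<1} \<inter> A i) x \<partial>?L)"
    by (subst emeasure_density) (auto intro!: nn_integral_cong split: split_indicator simp: PiE_Int[symmetric] simp del: nn_integral_indicator)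
  also have "\<dots> = (\<Prod>i\<in>I. emeasure lborel ({0<..<1} \<inter> A i))"
    using assms A by (subst nn_integral_indicator)
      (auto intro!: sets_PiM_I_finite L.emeasure_PiM simp: sets_unit_lborel)
  also have "\<dots> = (\<Prod>i\<in>I. emeasure unit_lborel (A i))"
  proof (intro prod.cong refl)
    fix i assume "i \<in> I"
    then have [measurable]: "A i \<in> sets borel" using A[of i] by (simp add: sets_unit_lborel)
    have "emeasure unit_lborel (A i) = (\<integral>\<^sup>+ x. indicator ({0<..<1} \<inter> A i) x \<partial>lborel)"
      unfolding unit_lborel_def
      by (subst emeasure_density)
        (auto intro!: nn_integral_cong split: split_indicator simp del: nn_integral_indicator)
    then show "emeasure lborel ({0<..<1} \<inter> A i) = emeasure unit_lborel (A i)" by simp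
  qed
  finally show "emeasure (density ?L (indicator (\<Pi>\<^sub>E i\<in>I. {0<..<1}))) (Pi\<^sub>E I A) =
      (\<Prod>i\<in>I. emeasure unit_lborel (A i))" .
qed

lemma AE_cube_measure:
  assumes "finite I"
  shows "AE x in cube_measure I. \<forall>i\<in>I. x i \<in> {0<..<1}"
proof -
  have [measurable]: "(\<Pi>\<^sub>E i\<in>I. {0<..<1}) \<in> sets (\<Pi>\<^sub>M i\<in>I. (lborel :: real measure))"
    using assms by (intro sets_PiM_I_finite) auto
  show ?thesis
    unfolding cube_measure_eq_density[OF assms]
    by (subst AE_density) (auto intro!: AE_I2 simp: PiE_iff split: split_indicator_asm)
qed

text \<open>Factors that depend on disjoint sets of coordinates integrate independently. The restrictions express this
dependence while all functions live on the full product space.\<close>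

lemma nn_integral_cube_product:
  assumes "finite I" "finite J" "I \<inter> J = {}"
    and [measurable]: "g \<in> borel_measurable (cube_measure I)" "h \<in> borel_measurable (cube_measure J)"
  shows "(\<integral>\<^sup>+ x. g (restrict x I) * h (restrict x J) \<partial>cube_measure (I \<union> J)) =
      (\<integral>\<^sup>+ x. g x \<partial>cube_measure I) * (\<integral>\<^sup>+ x. h x \<partial>cube_measure J)"
proof -
  have [measurable]: "(\<lambda>x. restrict x I) \<in> cube_measure (I \<union> J) \<rightarrow>\<^sub>M cube_measure I"
    "(\<lambda>x. restrict x J) \<in> cube_measure (I \<union> J) \<rightarrow>\<^sub>M cube_measure J"
    by (auto intro!: measurable_restrict_subset)
  have "(\<integral>\<^sup>+ x. g (restrict x I) * h (restrict x J) \<partial>cube_measure (I \<union> J)) =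
      (\<integral>\<^sup>+ x. (\<integral>\<^sup>+ y. g (restrict (merge I J (x, y)) I) * h (restrict (merge I J (x, y)) J)
        \<partial>cube_measure J) \<partial>cube_measure I)"
    using assms(1-3) by (subst U.product_nn_integral_fold) simp_all
  also have "\<dots> = (\<integral>\<^sup>+ x. (\<integral>\<^sup>+ y. g x * h y \<partial>cube_measure J) \<partial>cube_measure I)"
    using assms(3) by (intro nn_integral_cong) (simp add: space_PiM PiE_restrict)
  also have "\<dots> = (\<integral>\<^sup>+ x. g x \<partial>cube_measure I) * (\<integral>\<^sup>+ x. h x \<partial>cube_measure J)"
    by (simp add: nn_integral_cmult nn_integral_multc)
  finally show ?thesis .
qed

lemma integral_cube_product:
  fixes g h :: "(nat \<Rightarrow> real) \<Rightarrow> complex"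
  assumes fin: "finite I" "finite J" "I \<inter> J = {}"
    and g: "integrable (cube_measure I) g" and h: "integrable (cube_measure J) h"
  shows "integrable (cube_measure (I \<union> J)) (\<lambda>x. g (restrict x I) * h (restrict x J))" (is ?int)
    and "(\<integral>x. g (restrict x I) * h (restrict x J) \<partial>cube_measure (I \<union> J)) =
      (\<integral>x. g x \<partial>cube_measure I) * (\<integral>x. h x \<partial>cube_measure J)"
proof -
  note [measurable] = borel_measurable_integrable[OF g] borel_measurable_integrable[OF h]
  have [measurable]: "(\<lambda>x. restrict x I) \<in> cube_measure (I \<union> J) \<rightarrow>\<^sub>M cube_measure I"
    "(\<lambda>x. restrict x J) \<in> cube_measure (I \<union> J) \<rightarrow>\<^sub>M cube_measure J"
    by (auto intro!: measurable_restrict_subset)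
  show ?int
  proof (rule integrableI_bounded)
    have "(\<integral>\<^sup>+ x. norm (g (restrict x I) * h (restrict x J)) \<partial>cube_measure (I \<union> J)) =
      (\<integral>\<^sup>+ x. norm (g x) \<partial>cube_measure I) * (\<integral>\<^sup>+ x. norm (h x) \<partial>cube_measure J)"
      using nn_integral_cube_product[OF fin, of "\<lambda>x. norm (g x)" "\<lambda>x. norm (h x)"]
      by (simp add: norm_mult ennreal_mult)
    also have "\<dots> < \<infinity>"
      using g h by (simp add: integrable_iff_bounded ennreal_mult_less_top)
    finally show "(\<integral>\<^sup>+ x. norm (g (restrict x I) * h (restrict x J)) \<partial>cube_measure (I \<union> J)) < \<infinity>" .
  qed simp
  then have "(\<integral>x. g (restrict x I) * h (restrict x J) \<partial>cube_measure (I \<union> J)) =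
      (\<integral>x. (\<integral>y. g (restrict (merge I J (x, y)) I) * h (restrict (merge I J (x, y)) J)
        \<partial>cube_measure J) \<partial>cube_measure I)"
    using fin by (subst U.product_integral_fold) simp_all
  also have "\<dots> = (\<integral>x. (\<integral>y. g x * h y \<partial>cube_measure J) \<partial>cube_measure I)"
    using fin(3) by (intro Bochner_Integration.integral_cong refl) (simp add: space_PiM PiE_restrict)
  finally show "(\<integral>x. g (restrict x I) * h (restrict x J) \<partial>cube_measure (I \<union> J)) =
      (\<integral>x. g x \<partial>cube_measure I) * (\<integral>x. h x \<partial>cube_measure J)"
    by simp
qed

text \<open>For $-1<\mathrm{Re}(s)<0$ the integrand is unbounded near $0$. The fundamental theorem of calculus for
functions that are differentiable in the interior only still gives the Henstock-Kurzweil integral, and absolute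
integrability comes from the same computation for the real exponent $\mathrm{Re}(s)$.\<close>

lemma has_bochner_integral_unit_powr:
  assumes "Re s > -1"
  shows "has_bochner_integral unit_lborel (\<lambda>x. complex_of_real x powr s) (1 / (s + 1))"
proof -
  have FTC: "((\<lambda>x. complex_of_real x powr s) has_integral 1 / (s + 1)) {0..1}"
    if "Re s > -1" for s
  proof -
    have "s + 1 \<noteq> 0" using that by (auto simp: complex_eq_iff)
    have "((\<lambda>x. complex_of_real x powr s) has_integral
        (of_real 1 powr (s + 1) / (s + 1) - of_real 0 powr (s + 1) / (s + 1))) {0..1}"
    proof (rule fundamental_theorem_of_calculus_interior)
      show "continuous_on {0..1} (\<lambda>x. complex_of_real x powr (s + 1) / (s + 1))"
        using that \<open>s + 1 \<noteq> 0\<close>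
        by (intro continuous_intros continuous_on_powr_complex) auto
      fix x :: real assume x: "x \<in> {0<..<1}"
      have "((\<lambda>z. z powr (s + 1) / (s + 1)) has_field_derivative of_real x powr s) (at (of_real x))"
        using x \<open>s + 1 \<noteq> 0\<close> by (auto intro!: derivative_eq_intros)
      then show "((\<lambda>x. of_real x powr (s + 1) / (s + 1)) has_vector_derivative
          complex_of_real x powr s) (at x)"
        by (rule has_vector_derivative_real_field)
    qed simp
    then show ?thesis by simp
  qed
  let ?f = "\<lambda>x. indicator {0<..<1} x *\<^sub>R (complex_of_real x powr s)"
  have meas: "?f \<in> borel_measurable lborel" unfolding powr_def by measurable
  have int: "integrable lborel ?f"
  proof (rule integrableI_bounded[OF meas])
    have "((\<lambda>x. Re (complex_of_real x powr of_real (Re s))) has_integral Re (of_real (1 / (Re s + 1)))) {0..1}"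
      using FTC[of "of_real (Re s)"] assms by (intro has_integral_Re) auto
    then have "((\<lambda>x. x powr Re s) has_integral (1 / (Re s + 1))) {0..1}"
      unfolding Re_complex_of_real by (rule has_integral_eq[rotated]) (auto simp: powr_of_real)
    then have "(\<integral>\<^sup>+ x. ennreal (x powr Re s) * indicator {0..1} x \<partial>lborel) = ennreal (1 / (Re s + 1))"
      by (intro nn_integral_has_integral_lebesgue') auto
    moreover have "(\<integral>\<^sup>+ x. norm (?f x) \<partial>lborel) \<le> (\<integral>\<^sup>+ x. ennreal (x powr Re s) * indicator {0..1} x \<partial>lborel)"
      by (intro nn_integral_mono) (auto split: split_indicator simp: norm_powr_real_powr)
    ultimately show "(\<integral>\<^sup>+ x. norm (?f x) \<partial>lborel) < \<infinity>"
      by (metis ennreal_less_top infinity_ennreal_def order.strict_trans1)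
  qed
  have "(?f has_integral integral\<^sup>L lborel ?f) UNIV"
    by (rule has_integral_integral_lborel[OF int])
  moreover have "(?f has_integral 1 / (s + 1)) UNIV"
  proof -
    have "((\<lambda>x. complex_of_real x powr s) has_integral 1 / (s + 1)) {0<..<1}"
      using FTC[OF assms] has_integral_Icc_iff_Ioo by blast
    then have "((\<lambda>x. if x \<in> {0<..<1} then complex_of_real x powr s else 0) has_integral 1 / (s + 1)) UNIV"
      by (subst has_integral_restrict_UNIV)
    then show ?thesis
      by (rule has_integral_eq_rhs[OF has_integral_eq[rotated]]) auto
  qed
  ultimately have "integral\<^sup>L lborel ?f = 1 / (s + 1)" by (rule has_integral_unique)
  then have "has_bochner_integral lborel ?f (1 / (s + 1))"
    using int by (simp add: has_bochner_integral_iff)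
  moreover have "(\<lambda>x. complex_of_real x powr s) \<in> borel_measurable lborel"
    unfolding powr_def by measurable
  ultimately have "has_bochner_integral (density lborel (\<lambda>x. ennreal (indicator {0<..<1} x)))
      (\<lambda>x. complex_of_real x powr s) (1 / (s + 1))"
    by (intro has_bochner_integral_density) auto
  then show ?thesis by (simp add: unit_lborel_def ennreal_indicator)
qed

lemma has_bochner_integral_block_powr:
  assumes "finite B" "Re s > -1"
  shows "has_bochner_integral (cube_measure B) (\<lambda>x. complex_of_real (\<Prod>i\<in>B. x i) powr s) (1 / (s + 1) ^ card B)"
proof -
  have *: "has_bochner_integral (cube_measure B) (\<lambda>x. \<Prod>i\<in>B. complex_of_real (x i) powr s) (1 / (s + 1) ^ card B)"
    using assms has_bochner_integral_unit_powr[of s]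
      U.product_integrable_prod[of B "\<lambda>_ x. complex_of_real x powr s"]
      U.product_integral_prod[of B "\<lambda>_ x. complex_of_real x powr s"]
    by (simp add: has_bochner_integral_iff power_divide)
  have "(\<Prod>i\<in>A. complex_of_real (x i) powr s) = complex_of_real (\<Prod>i\<in>A. x i) powr s"
    if "finite A" "\<forall>i\<in>A. x i \<in> {0<..<1}" for x and A :: "nat set"
    using that
  proof (induction A)
    case (insert a A)
    then show ?case
      by (simp add: powr_times_real less_imp_le prod_nonneg flip: of_real_prod)
  qed simp
  then have AE: "AE x in cube_measure B. (\<Prod>i\<in>B. complex_of_real (x i) powr s) = complex_of_real (\<Prod>i\<in>B. x i) powr s"
    using AE_cube_measure[OF assms(1)] assms(1) by (force elim: eventually_mono)
  have [measurable]: "(\<lambda>x. \<Prod>i\<in>B. complex_of_real (x i) powr s) \<in> borel_measurable (cube_measure B)"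
    "(\<lambda>x. complex_of_real (\<Prod>i\<in>B. x i) powr s) \<in> borel_measurable (cube_measure B)"
    unfolding powr_def by measurable
  show ?thesis
    using * integrable_cong_AE[OF _ _ AE] integral_cong_AE[OF _ _ AE] by (simp add: has_bochner_integral_iff)
qed

section \<open>Blocks of coordinates\<close>

definition block_products :: "nat set list \<Rightarrow> (nat \<Rightarrow> real) \<Rightarrow> real list" where
  "block_products Bs x = map (\<lambda>B. \<Prod>i\<in>B. x i) Bs"

text \<open>Nonempty blocks have products strictly below $1$ on the open cube, which keeps the nodes distinct.\<close>

primrec disjoint_blocks :: "nat set list \<Rightarrow> bool" where
  "disjoint_blocks [] = True"
| "disjoint_blocks (B # Bs) =
    (finite B \<and> B \<noteq> {} \<and> B \<inter> \<Union>(set Bs) = {} \<and> disjoint_blocks Bs)"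

lemma block_products_simps [simp]:
  "block_products [] x = []"
  "block_products (B # Bs) x = (\<Prod>i\<in>B. x i) # block_products Bs x"
  "length (block_products Bs x) = length Bs"
  by (simp_all add: block_products_def)

lemma block_products_restrict: "\<Union>(set Bs) \<subseteq> I \<Longrightarrow> block_products Bs (restrict x I) = block_products Bs x"
  unfolding block_products_def by (intro map_cong prod.cong refl) auto

lemma finite_disjoint_blocks: "disjoint_blocks Bs \<Longrightarrow> finite (\<Union>(set Bs))"
  by (induction Bs) auto

lemma disjoint_blocks_drop: "disjoint_blocks Bs \<Longrightarrow> disjoint_blocks (drop n Bs)"
proof (induction n arbitrary: Bs)
  case (Suc n)
  then show ?case by (cases Bs) auto
qed simp

lemma measurable_nodes_block_products:
  assumes "\<Union>(set Bs) \<subseteq> I" "i \<le> length Bs"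
  shows "(\<lambda>x. nodes (block_products Bs x) ! i) \<in> borel_measurable (cube_measure I)"
  using assms
proof (induction Bs arbitrary: i)
  case (Cons B Bs)
  show ?case
  proof (cases i)
    case (Suc j)
    then have "(\<lambda>x. nodes (block_products Bs x) ! j) \<in> borel_measurable (cube_measure I)"
      using Cons by auto
    moreover have "(\<lambda>x. \<Prod>i\<in>B. x i) \<in> borel_measurable (cube_measure I)"
      using Cons.prems by (intro borel_measurable_prod) auto
    ultimately show ?thesis using Suc Cons.prems by (simp add: nth_map)
  qed simp
qed auto

lemma measurable_star_kernel [measurable]:
  assumes "\<Union>(set Bs) \<subseteq> I"
  shows "(\<lambda>x. star_kernel s (block_products Bs x)) \<in> borel_measurable (cube_measure I)"
proof -
  have [measurable]: "(\<lambda>x. nodes (block_products Bs x) ! i) \<in> borel_measurable (cube_measure I)"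
    if "i \<in> {..<Suc (length Bs)}" for i
    using measurable_nodes_block_products[OF assms] that by auto
  show ?thesis
    unfolding star_kernel_def divided_difference_def length_nodes block_products_simps powr_def
    by (intro borel_measurable_sum borel_measurable_divide borel_measurable_of_real
        borel_measurable_prod borel_measurable_diff) measurable
qed

lemma prod_in_unit_interval:
  fixes x :: "nat \<Rightarrow> real"
  assumes "finite B" "B \<noteq> {}" "\<And>i. i \<in> B \<Longrightarrow> x i \<in> {0<..<1}"
  shows "(\<Prod>i\<in>B. x i) \<in> {0<..<1}"
  using assms
proof (induction B rule: finite_ne_induct)
  case (insert a B)
  then have "0 < x a" "x a < 1" "0 < (\<Prod>i\<in>B. x i)" "(\<Prod>i\<in>B. x i) < 1" by auto
  then have "x a * (\<Prod>i\<in>B. x i) < 1 * 1" by (intro mult_strict_mono) auto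
  with insert \<open>0 < x a\<close> \<open>0 < (\<Prod>i\<in>B. x i)\<close> show ?case by simp
qed auto

lemma block_products_in_unit_interval:
  assumes "disjoint_blocks Bs" "\<And>i. i \<in> \<Union>(set Bs) \<Longrightarrow> x i \<in> {0<..<1}"
  shows "set (block_products Bs x) \<subseteq> {0<..<1}"
  using assms
proof (induction Bs)
  case (Cons B Bs)
  then have "(\<Prod>i\<in>B. x i) \<in> {0<..<1}" by (intro prod_in_unit_interval) auto
  with Cons show ?case by simp
qed simp

lemma AE_block_products:
  assumes "disjoint_blocks Bs"
  shows "AE x in cube_measure (\<Union>(set Bs)). set (block_products Bs x) \<subseteq> {0<..<1}"
  using AE_cube_measure[OF finite_disjoint_blocks[OF assms]]
  by (rule AE_mp) (intro AE_I2 impI block_products_in_unit_interval[OF assms], blast)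

lemma has_bochner_integral_block_powr_real:
  assumes "finite B" "B \<noteq> {}" "a > -1"
  shows "has_bochner_integral (cube_measure B) (\<lambda>x. (\<Prod>i\<in>B. x i) powr a) (1 / (a + 1) ^ card B)"
proof -
  note * = has_bochner_integral_block_powr[OF assms(1), of "of_real a"]
  have "has_bochner_integral (cube_measure B) (\<lambda>x. Re (complex_of_real (\<Prod>i\<in>B. x i) powr of_real a))
      (Re (of_real (1 / (a + 1) ^ card B)))"
    using * assms(3) by (intro has_bochner_integral_Re) simp_all
  then have int: "has_bochner_integral (cube_measure B) (\<lambda>x. Re (complex_of_real (\<Prod>i\<in>B. x i) powr of_real a))
      (1 / (a + 1) ^ card B)" by simp
  have [measurable]: "(\<lambda>x. \<Prod>i\<in>B. x i) \<in> borel_measurable (cube_measure B)"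
    by (intro borel_measurable_prod) auto
  have AE: "AE x in cube_measure B. Re (complex_of_real (\<Prod>i\<in>B. x i) powr of_real a) = (\<Prod>i\<in>B. x i) powr a"
    using AE_cube_measure[OF assms(1)]
  proof (rule AE_mp, intro AE_I2 impI)
    fix x :: "nat \<Rightarrow> real" assume "\<forall>i\<in>B. x i \<in> {0<..<1}"
    then have "(\<Prod>i\<in>B. x i) \<ge> 0" by (intro prod_nonneg) auto
    then show "Re (complex_of_real (\<Prod>i\<in>B. x i) powr of_real a) = (\<Prod>i\<in>B. x i) powr a"
      by (simp only: powr_of_real Re_complex_of_real)
  qed
  have "(\<lambda>x. Re (complex_of_real (\<Prod>i\<in>B. x i) powr of_real a)) \<in> borel_measurable (cube_measure B)"
    by (rule borel_measurable_has_bochner_integral[OF int])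
  moreover have "(\<lambda>x. (\<Prod>i\<in>B. x i) powr a) \<in> borel_measurable (cube_measure B)" by measurable
  ultimately show ?thesis
    using int integrable_cong_AE[OF _ _ AE] integral_cong_AE[OF _ _ AE]
    by (simp add: has_bochner_integral_iff)
qed

lemma nn_integral_block_powr:
  assumes "finite B" "B \<noteq> {}" "a > -1"
  shows "(\<integral>\<^sup>+ x. ennreal ((\<Prod>i\<in>B. x i) powr a) \<partial>cube_measure B) = ennreal (1 / (a + 1) ^ card B)"
  using has_bochner_integral_block_powr_real[OF assms]
  by (subst nn_integral_eq_integral) (auto simp: has_bochner_integral_iff)

lemma nn_integral_block_powr_diff:
  assumes "finite B" "B \<noteq> {}" "a > -1/2"
  shows "(\<integral>\<^sup>+ x. ennreal ((\<Prod>i\<in>B. x i) powr (a - 1/2) - (\<Prod>i\<in>B. x i) powr a) \<partial>cube_measure B)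
    = ennreal (1 / (a + 1/2) ^ card B - 1 / (a + 1) ^ card B)"
proof -
  have *: "has_bochner_integral (cube_measure B) (\<lambda>x. (\<Prod>i\<in>B. x i) powr (a - 1/2) - (\<Prod>i\<in>B. x i) powr a)
    (1 / (a - 1/2 + 1) ^ card B - 1 / (a + 1) ^ card B)"
    using assms by (intro has_bochner_integral_diff has_bochner_integral_block_powr_real) auto
  have "AE x in cube_measure B. 0 \<le> (\<Prod>i\<in>B. x i) powr (a - 1/2) - (\<Prod>i\<in>B. x i) powr a"
    using AE_cube_measure[OF assms(1)]
  proof (rule AE_mp, intro AE_I2 impI)
    fix x :: "nat \<Rightarrow> real" assume "\<forall>i\<in>B. x i \<in> {0<..<1}"
    then have "(\<Prod>i\<in>B. x i) \<in> {0<..<1}" using assms by (intro prod_in_unit_interval) auto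
    then show "0 \<le> (\<Prod>i\<in>B. x i) powr (a - 1/2) - (\<Prod>i\<in>B. x i) powr a"
      by (auto intro: powr_mono')
  qed
  then show ?thesis
    using * by (subst nn_integral_eq_integral) (auto simp: has_bochner_integral_iff add.commute)
qed

text \<open>This is what makes the induction on the number of blocks run: the first block enters the integrands only
through its product, and the rest is an instance with one block fewer.\<close>

lemma nn_integral_split_block:
  assumes "disjoint_blocks (B # Bs)"
    and g: "g \<in> borel_measurable borel"
    and H: "(\<lambda>x. H (block_products Bs x)) \<in> borel_measurable (cube_measure (\<Union>(set Bs)))"
  shows "(\<integral>\<^sup>+ x. g (\<Prod>i\<in>B. x i) * H (block_products Bs x) \<partial>cube_measure (\<Union>(set (B # Bs)))) =
    (\<integral>\<^sup>+ x. g (\<Prod>i\<in>B. x i) \<partial>cube_measure B) * (\<integral>\<^sup>+ x. H (block_products Bs x) \<partial>cube_measure (\<Union>(set Bs)))"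
proof -
  let ?J = "\<Union>(set Bs)"
  have [measurable]: "(\<lambda>x. g (\<Prod>i\<in>B. x i)) \<in> borel_measurable (cube_measure B)"
    by (rule measurable_compose[OF _ g]) (intro borel_measurable_prod, auto)
  have "(\<integral>\<^sup>+ x. g (\<Prod>i\<in>B. restrict x B i) * H (block_products Bs (restrict x ?J)) \<partial>cube_measure (B \<union> ?J)) =
    (\<integral>\<^sup>+ x. g (\<Prod>i\<in>B. x i) \<partial>cube_measure B) * (\<integral>\<^sup>+ x. H (block_products Bs x) \<partial>cube_measure ?J)"
    using assms(1) finite_disjoint_blocks[of Bs] H by (intro nn_integral_cube_product) auto
  then show ?thesis by (simp add: block_products_restrict cong: prod.cong)
qed

lemma integral_split_block:
  assumes "disjoint_blocks (B # Bs)" "Re s > -1"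
    and H: "integrable (cube_measure (\<Union>(set Bs))) (\<lambda>x. H (block_products Bs x))"
  shows "has_bochner_integral (cube_measure (\<Union>(set (B # Bs))))
      (\<lambda>x. complex_of_real (\<Prod>i\<in>B. x i) powr s * H (block_products Bs x))
      (1 / (s + 1) ^ card B * (\<integral>x. H (block_products Bs x) \<partial>cube_measure (\<Union>(set Bs))))"
proof -
  let ?J = "\<Union>(set Bs)"
  have B: "has_bochner_integral (cube_measure B) (\<lambda>x. complex_of_real (\<Prod>i\<in>B. x i) powr s) (1 / (s + 1) ^ card B)"
    using assms by (intro has_bochner_integral_block_powr) auto
  have "has_bochner_integral (cube_measure (B \<union> ?J))
      (\<lambda>x. complex_of_real (\<Prod>i\<in>B. restrict x B i) powr s * H (block_products Bs (restrict x ?J)))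
      (1 / (s + 1) ^ card B * (\<integral>x. H (block_products Bs x) \<partial>cube_measure ?J))"
    using assms(1) finite_disjoint_blocks[of Bs] H B
      integral_cube_product[of B ?J "\<lambda>x. complex_of_real (\<Prod>i\<in>B. x i) powr s" "\<lambda>x. H (block_products Bs x)"]
    unfolding has_bochner_integral_iff by auto
  then show ?thesis by (simp add: block_products_restrict cong: prod.cong)
qed

section \<open>Elementary estimates\<close>

lemma norm_exp_minus_one_le:
  fixes w :: complex
  assumes "Re w \<le> 0"
  shows "norm (exp w - 1) \<le> norm w"
proof -
  have "norm (exp w - exp 0) \<le> 1 * norm (w - 0)"
  proof (rule field_differentiable_bound[where f' = exp and S = "{w. Re w \<le> 0}"])
    show "convex {w. Re w \<le> 0}" by (rule convex_halfspace_Re_le)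
  qed (use assms in \<open>auto intro!: derivative_eq_intros\<close>)
  then show ?thesis by simp
qed

text \<open>The bound $|z^s-1|\le|s|\,|\log z|$ is weakened by $-\log z\le 2(z^{-1/2}-1)$ so that only powers of $z$,
whose integrals are explicit, remain.\<close>

lemma norm_powr_minus_one_le:
  assumes "0 < z" "z < 1" "Re s \<ge> 0"
  shows "norm (complex_of_real z powr s - 1) \<le> 2 * norm s * (z powr (-1/2) - 1)"
proof -
  have "Re s * ln z \<le> 0" using assms by (simp add: mult_nonneg_nonpos)
  then have "norm (complex_of_real z powr s - 1) \<le> norm (s * of_real (ln z))"
    using assms norm_exp_minus_one_le[of "s * of_real (ln z)"]
    by (simp add: powr_def Ln_of_real)
  also have "\<dots> = norm s * (- ln z)" using assms by (simp add: norm_mult)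
  also have "- ln z \<le> 2 * (z powr (-1/2) - 1)"
    using assms ln_le_minus_one[of "z powr (-1/2)"] by (simp add: ln_powr)
  then have "norm s * (- ln z) \<le> norm s * (2 * (z powr (-1/2) - 1))"
    by (intro mult_left_mono) auto
  finally show ?thesis by (simp add: mult_ac)
qed

lemma norm_powr_diff_le:
  assumes "0 < z" "z < 1" "Re s \<ge> 0"
  shows "norm (complex_of_real z powr (s + of_nat m) - of_real z powr of_nat m) \<le>
    2 * norm s * (z powr (real m - 1/2) - z powr real m)"
proof -
  have "complex_of_real z powr (s + of_nat m) - of_real z powr of_nat m =
      of_real (z ^ m) * (of_real z powr s - 1)"
    using assms by (simp add: powr_add algebra_simps)
  then have "norm (complex_of_real z powr (s + of_nat m) - of_real z powr of_nat m) =
      z ^ m * norm (of_real z powr s - 1)"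
    using assms by (simp add: norm_mult norm_power)
  also have "\<dots> \<le> z ^ m * (2 * norm s * (z powr (-1/2) - 1))"
    using assms by (intro mult_left_mono norm_powr_minus_one_le) auto
  also have "\<dots> = 2 * norm s * (z powr (real m - 1/2) - z powr real m)"
    using assms powr_add[of z "real m" "-1/2"] by (simp add: powr_realpow algebra_simps)
  finally show ?thesis .
qed

text \<open>Stated in extended nonnegative reals, so that the sum can later be interchanged with an integral
without any prior knowledge of convergence.\<close>

lemma norm_le_suminf_differences:
  fixes f :: "nat \<Rightarrow> complex"
  assumes "f \<longlonglongrightarrow> 0"
  shows "ennreal (norm (f M)) \<le> (\<Sum>m. ennreal (norm (f (Suc (m + M)) - f (m + M))))" (is "_ \<le> ?S")
proof (rule LIMSEQ_le_const)
  have "(\<lambda>N. ennreal (norm (f (N + M)))) \<longlonglongrightarrow> ennreal (norm (0 :: complex))"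
    using LIMSEQ_ignore_initial_segment[OF assms, of M] by (intro tendsto_intros)
  then have "(\<lambda>N. ennreal (norm (f (N + M))) + ?S) \<longlonglongrightarrow> ennreal (norm (0 :: complex)) + ?S"
    by (intro tendsto_add tendsto_const)
  then show "(\<lambda>N. ennreal (norm (f (N + M))) + ?S) \<longlonglongrightarrow> ?S" by simp
  have "ennreal (norm (f M)) \<le> ennreal (norm (f (N + M))) + ?S" for N
  proof -
    have "norm (f M) \<le> norm (f (N + M)) + (\<Sum>m<N. norm (f (Suc (m + M)) - f (m + M)))"
    proof (induction N)
      case (Suc N)
      have "norm (f (N + M)) \<le> norm (f (Suc (N + M))) + norm (f (Suc (N + M)) - f (N + M))"
        by norm
      with Suc show ?case by simp
    qed simp
    then have "ennreal (norm (f M)) \<le> ennreal (norm (f (N + M)) + (\<Sum>m<N. norm (f (Suc (m + M)) - f (m + M))))"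
      by (rule ennreal_leI)
    also have "\<dots> = ennreal (norm (f (N + M))) + (\<Sum>m<N. ennreal (norm (f (Suc (m + M)) - f (m + M))))"
      by (simp add: ennreal_plus sum_nonneg)
    also have "\<dots> \<le> ennreal (norm (f (N + M))) + ?S"
      by (intro add_left_mono sum_le_suminf) auto
    finally show ?thesis .
  qed
  then show "\<exists>N. \<forall>n\<ge>N. ennreal (norm (f M)) \<le> ennreal (norm (f (n + M))) + ?S" by blast
qed

text \<open>Bernoulli's inequality for $(1-1/(2n))^k$; the crude factor $2^k$ comes from $n-1/2\ge n/2$.\<close>

lemma inverse_power_diff_le:
  fixes n :: real
  assumes "n \<ge> 1" "k \<ge> 1"
  shows "1 / (n - 1/2) ^ k - 1 / n ^ k \<le> real k * 2 ^ k / n\<^sup>2"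
proof -
  have pos: "n - 1/2 > 0" using assms by simp
  have "1 + real k * (- 1 / (2 * n)) \<le> (1 + - 1 / (2 * n)) ^ k"
    using assms by (intro Bernoulli_inequality) (simp add: field_simps)
  also have "1 + - 1 / (2 * n) = (n - 1/2) / n" using assms by (simp add: field_simps)
  finally have B: "1 - (n - 1/2) ^ k / n ^ k \<le> real k / (2 * n)" by (simp add: power_divide)
  have "(n / 2) ^ k \<le> (n - 1/2) ^ k" using assms by (intro power_mono) auto
  have "1 / (n - 1/2) ^ k - 1 / n ^ k = (1 - (n - 1/2) ^ k / n ^ k) / (n - 1/2) ^ k"
    using pos by (simp add: field_simps)
  also have "\<dots> \<le> (real k / (2 * n)) / (n / 2) ^ k"
    using B \<open>(n / 2) ^ k \<le> (n - 1/2) ^ k\<close> assms pos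
    by (intro frac_le) auto
  also have "\<dots> = real k * 2 ^ k / (2 * n * n ^ k)" by (simp add: power_divide)
  also have "\<dots> \<le> real k * 2 ^ k / n\<^sup>2"
  proof (intro divide_left_mono)
    have "n ^ 1 \<le> n ^ k" using assms by (intro power_increasing) auto
    then have "n * n ^ 1 \<le> n * n ^ k" using assms by (intro mult_left_mono) auto
    moreover have "0 \<le> n * n ^ k" using assms by simp
    ultimately show "n\<^sup>2 \<le> 2 * n * n ^ k" by (simp add: power2_eq_square)
  qed (use assms in auto)
  finally show ?thesis .
qed

text \<open>Compares $n^{-3/2}$ with the increment of a telescoping sum; any constant that does not depend on $n$
would serve, and $4$ suffices by $\sqrt{n+1}\le\frac32\sqrt n$.\<close>

lemma inverse_three_halves_le:
  fixes n :: real
  assumes "n \<ge> 1"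
  shows "1 / (n * sqrt n) \<le> 4 * (1 / sqrt n - 1 / sqrt (n + 1))"
proof -
  define a b where "a = sqrt n" and "b = sqrt (n + 1)"
  have ab: "a > 0" "b > 0" "a\<^sup>2 = n" "b\<^sup>2 = n + 1" using assms by (auto simp: a_def b_def)
  have "b\<^sup>2 \<le> (3/2 * a)\<^sup>2" using ab assms by (simp add: power_mult_distrib) (simp add: power2_eq_square)
  then have "b \<le> 3/2 * a" by (rule power2_le_imp_le) (use ab in auto)
  have "(b - a) * (b + a) = 1" using ab by (simp add: algebra_simps power2_eq_square)
  then have diff: "b - a = 1 / (b + a)" using ab by (simp add: field_simps)
  have "b * (b + a) \<le> (3/2 * a) * (3/2 * a + a)"
    using ab \<open>b \<le> 3/2 * a\<close> by (intro mult_mono) auto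
  also have "\<dots> = 15/4 * a\<^sup>2" by (simp add: power2_eq_square algebra_simps)
  also have "\<dots> \<le> 4 * a\<^sup>2" by (intro mult_right_mono) auto
  finally have "1 / (4 * a\<^sup>2) \<le> 1 / (b * (b + a))" using ab by (intro divide_left_mono) auto
  then have "4 / a * (1 / (4 * a\<^sup>2)) \<le> 4 / a * (1 / (b * (b + a)))" using ab by (intro mult_left_mono) auto
  also have "\<dots> = 4 * ((b - a) / (a * b))" using ab by (simp add: diff mult_ac)
  also have "\<dots> = 4 * (1 / a - 1 / b)" using ab by (simp add: field_simps)
  finally show ?thesis using ab by (simp add: a_def b_def mult_ac)
qed

lemma suminf_three_halves_le:
  "(\<Sum>m. ennreal (1 / (real (m + M + 1) * sqrt (real (m + M + 1))))) \<le> ennreal (4 / sqrt (real M + 1))"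
proof -
  let ?f = "\<lambda>m. 4 / sqrt (real (m + M + 1))"
  have "?f \<longlonglongrightarrow> 0"
    by (intro real_tendsto_divide_at_top[OF tendsto_const] filterlim_compose[OF sqrt_at_top])
      real_asymp
  then have sums: "(\<lambda>m. ?f m - ?f (Suc m)) sums (?f 0 - 0)" by (rule telescope_sums')
  have nonneg: "0 \<le> ?f m - ?f (Suc m)" for m by (simp add: frac_le)
  have "(\<Sum>m. ennreal (1 / (real (m + M + 1) * sqrt (real (m + M + 1))))) \<le> (\<Sum>m. ennreal (?f m - ?f (Suc m)))"
  proof (intro suminf_le ennreal_leI summableI)
    fix m
    show "1 / (real (m + M + 1) * sqrt (real (m + M + 1))) \<le> ?f m - ?f (Suc m)"
      using inverse_three_halves_le[of "real (m + M + 1)"] by (simp add: algebra_simps)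
  qed
  also have "\<dots> = ennreal (?f 0 - 0)"
    using sums nonneg by (intro suminf_ennreal_eq) auto
  finally show ?thesis by (simp add: add.commute)
qed

section \<open>Mean bounds for the integrand\<close>

text \<open>By \<open>star_kernel_Suc\<close> the integral $N_n$ of the absolute value satisfies $N_{n+1}\le N_n+N'_{n+1}/(n+1)$, where $N'$
belongs to the remaining blocks, and it vanishes at $n=0$. (The true order is at most a power of $\log n$; the bound
$O(\sqrt n)$ is reproduced by summation and is small enough.)\<close>

lemma nn_integral_star_kernel_nat:
  assumes "disjoint_blocks Bs"
  shows "\<exists>c\<ge>0. \<forall>n. (\<integral>\<^sup>+ x. ennreal (norm (star_kernel (of_nat (Suc n)) (block_products Bs x)))
      \<partial>cube_measure (\<Union>(set Bs))) \<le> ennreal (c * sqrt (real (Suc n)))"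
  using assms
proof (induction Bs)
  case Nil
  have "(\<integral>\<^sup>+ x. ennreal (norm (star_kernel (of_nat (Suc n)) (block_products [] x)))
      \<partial>cube_measure (\<Union>(set []))) = 1" for n
    by (simp add: space_PiM_empty)
  then show ?case by (intro exI[of _ 1]) (simp add: ennreal_leI flip: ennreal_1)
next
  case (Cons B Bs)
  note ok = Cons.prems
  have B: "finite B" "B \<noteq> {}" using ok by auto
  have [measurable]: "(\<lambda>x. \<Prod>i\<in>B. x i) \<in> borel_measurable (cube_measure (\<Union>(set (B # Bs))))"
    by (intro borel_measurable_prod) auto
  define N where "N n Cs = (\<integral>\<^sup>+ x. ennreal (norm (star_kernel (of_nat n) (block_products Cs x)))
      \<partial>cube_measure (\<Union>(set Cs)))" for n and Cs :: "nat set list"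
  obtain c where c: "c \<ge> 0" "\<And>n. N (Suc n) Bs \<le> ennreal (c * sqrt (real (Suc n)))"
    using Cons ok unfolding N_def by auto
  have step: "N (Suc n) (B # Bs) \<le> N n (B # Bs) + ennreal (c / sqrt (real (Suc n)))" for n
  proof -
    have "AE x in cube_measure (\<Union>(set (B # Bs))).
       ennreal (norm (star_kernel (of_nat (Suc n)) (block_products (B # Bs) x))) \<le>
       ennreal (norm (star_kernel (of_nat n) (block_products (B # Bs) x))) +
       ennreal ((\<Prod>i\<in>B. x i) powr real n) * ennreal (norm (star_kernel (of_nat (Suc n)) (block_products Bs x)))"
      using AE_block_products[OF ok]
    proof (rule AE_mp, intro AE_I2 impI)
      fix x assume x: "set (block_products (B # Bs) x) \<subseteq> {0<..<1}"
      let ?z = "\<Prod>i\<in>B. x i"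
      have z: "0 < ?z" using x by simp
      have "norm (star_kernel (of_nat (Suc n)) (block_products (B # Bs) x)) \<le>
        norm (star_kernel (of_nat n) (block_products (B # Bs) x)) +
        norm (complex_of_real ?z powr of_nat n * star_kernel (of_nat (Suc n)) (block_products Bs x))"
        using star_kernel_Suc[of ?z "block_products Bs x" "of_nat n"] x norm_triangle_ineq
        by (simp add: add.commute)
      also have "\<dots> = norm (star_kernel (of_nat n) (block_products (B # Bs) x)) +
        ?z powr real n * norm (star_kernel (of_nat (Suc n)) (block_products Bs x))"
        using z by (simp only: norm_mult norm_powr_real_powr Reals_of_real Re_complex_of_real
          less_imp_le complex_Re_of_nat)
      finally show "ennreal (norm (star_kernel (of_nat (Suc n)) (block_products (B # Bs) x))) \<le>
       ennreal (norm (star_kernel (of_nat n) (block_products (B # Bs) x))) +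
       ennreal (?z powr real n) * ennreal (norm (star_kernel (of_nat (Suc n)) (block_products Bs x)))"
        by (simp add: ennreal_leI flip: ennreal_plus ennreal_mult)
    qed
    then have "N (Suc n) (B # Bs) \<le> (\<integral>\<^sup>+ x. ennreal (norm (star_kernel (of_nat n) (block_products (B # Bs) x))) +
       ennreal ((\<Prod>i\<in>B. x i) powr real n) * ennreal (norm (star_kernel (of_nat (Suc n)) (block_products Bs x)))
        \<partial>cube_measure (\<Union>(set (B # Bs))))"
      unfolding N_def by (rule nn_integral_mono_AE)
    also have "\<dots> = N n (B # Bs) + (\<integral>\<^sup>+ x. ennreal ((\<Prod>i\<in>B. x i) powr real n) *
        ennreal (norm (star_kernel (of_nat (Suc n)) (block_products Bs x))) \<partial>cube_measure (\<Union>(set (B # Bs))))"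
      unfolding N_def by (rule nn_integral_add) measurable
    also have "(\<integral>\<^sup>+ x. ennreal ((\<Prod>i\<in>B. x i) powr real n) * ennreal (norm (star_kernel (of_nat (Suc n)) (block_products Bs x)))
        \<partial>cube_measure (\<Union>(set (B # Bs)))) = ennreal (1 / (real n + 1) ^ card B) * N (Suc n) Bs"
      unfolding N_def
      by (subst nn_integral_split_block[OF ok,
            where g = "\<lambda>z. ennreal (z powr real n)" and H = "\<lambda>v. ennreal (norm (star_kernel (of_nat (Suc n)) v))"])
        (auto simp: nn_integral_block_powr[OF B])
    also have "\<dots> \<le> ennreal (1 / (real n + 1)) * ennreal (c * sqrt (real (Suc n)))"
    proof (intro mult_mono c ennreal_leI)
      have "(real n + 1) ^ 1 \<le> (real n + 1) ^ card B"
        using B by (intro power_increasing) (auto simp: Suc_le_eq card_gt_0_iff)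
      then show "1 / (real n + 1) ^ card B \<le> 1 / (real n + 1)"
        by (intro divide_left_mono) auto
    qed auto
    also have "\<dots> = ennreal (1 / (real n + 1) * (c * sqrt (real (Suc n))))"
      using c(1) by (subst ennreal_mult[symmetric]) auto
    also have "1 / (real n + 1) * (c * sqrt (real (Suc n))) = c / sqrt (real (Suc n))"
      by (simp add: field_simps flip: real_sqrt_mult) 
    finally show ?thesis by (simp add: add_left_mono)
  qed
  have N0: "N 0 (B # Bs) = 0"
  proof -
    have "N 0 (B # Bs) = (\<integral>\<^sup>+ x. 0 \<partial>cube_measure (\<Union>(set (B # Bs))))"
      unfolding N_def using AE_block_products[OF ok]
      by (intro nn_integral_cong_AE, elim AE_mp) (auto intro!: AE_I2 simp: star_kernel_0)
    then show ?thesis by simp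
  qed
  have N: "N n (B # Bs) \<le> ennreal (2 * c * sqrt (real n))" for n
  proof (induction n)
    case (Suc n)
    have "1 / sqrt (real (Suc n)) \<le> 2 * (sqrt (real (Suc n)) - sqrt (real n))"
    proof -
      define a b where "a = sqrt (real n)" and "b = sqrt (real (Suc n))"
      have ab: "0 \<le> a" "a \<le> b" "0 < b" "a\<^sup>2 = real n" "b\<^sup>2 = real n + 1" by (auto simp: a_def b_def)
      have "1 = (b - a) * (b + a)" using ab by (simp add: algebra_simps power2_eq_square)
      also have "\<dots> \<le> (b - a) * (2 * b)" using ab by (intro mult_left_mono) auto
      finally have "1 / b \<le> 2 * (b - a)" using ab by (simp add: field_simps)
      then show ?thesis by (simp add: a_def b_def)
    qed
    then have "c * (1 / sqrt (real (Suc n))) \<le> c * (2 * (sqrt (real (Suc n)) - sqrt (real n)))"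
      using c by (intro mult_left_mono)
    then have le: "2 * c * sqrt (real n) + c / sqrt (real (Suc n)) \<le> 2 * c * sqrt (real (Suc n))"
      by (simp add: algebra_simps)
    have "N (Suc n) (B # Bs) \<le> ennreal (2 * c * sqrt (real n)) + ennreal (c / sqrt (real (Suc n)))"
      using step[of n] Suc by (meson add_right_mono order_trans)
    also have "\<dots> = ennreal (2 * c * sqrt (real n) + c / sqrt (real (Suc n)))"
      using c by (subst ennreal_plus) auto
    also have "\<dots> \<le> ennreal (2 * c * sqrt (real (Suc n)))" using le by (rule ennreal_leI)
    finally show ?case .
  qed (simp add: N0)
  show ?case
  proof (intro exI[of _ "2 * c"] conjI allI)
    show "0 \<le> 2 * c" using c by simp
    show "(\<integral>\<^sup>+ x. ennreal (norm (star_kernel (of_nat (Suc n)) (block_products (B # Bs) x)))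
        \<partial>cube_measure (\<Union>(set (B # Bs)))) \<le> ennreal (2 * c * sqrt (real (Suc n)))" for n
      using N[of "Suc n"] unfolding N_def .
  qed
qed

text \<open>The case \<open>M = 0\<close> gives integrability at \<open>s\<close>, because for a nonempty list of blocks the integrand at $0$ vanishes; the decay in \<open>M\<close> gives the
limit, and linearity in the norm of \<open>s\<close> gives its local uniformity. The exponent $1/2$ reproduces itself: a
bound of order $m^{-1/2}$ for the remaining blocks is multiplied by at most $1/m$ and then summed over $m>M$.\<close>

lemma nn_integral_star_kernel_shift:
  assumes "disjoint_blocks Bs"
  shows "\<exists>C\<ge>0. \<forall>s M. Re s > 0 \<longrightarrow>
      (\<integral>\<^sup>+ x. ennreal (norm (star_kernel (s + of_nat M) (block_products Bs x) - star_kernel (of_nat M) (block_products Bs x)))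
        \<partial>cube_measure (\<Union>(set Bs))) \<le> ennreal (C * norm s / sqrt (real M + 1))"
  using assms
proof (induction Bs)
  case Nil
  show ?case by (intro exI[of _ 0]) simp
next
  case (Cons B Bs)
  note ok = Cons.prems
  have B: "finite B" "B \<noteq> {}" and okBs: "disjoint_blocks Bs" using ok by auto
  have [measurable]: "(\<lambda>x. \<Prod>i\<in>B. x i) \<in> borel_measurable (cube_measure (\<Union>(set (B # Bs))))"
    by (intro borel_measurable_prod) auto
  define k where "k = card B"
  have k: "k \<ge> 1" using B by (simp add: k_def Suc_le_eq card_gt_0_iff)
  define E where "E s M Cs =
      (\<integral>\<^sup>+ x. ennreal (norm (star_kernel (s + of_nat M) (block_products Cs x) - star_kernel (of_nat M) (block_products Cs x)))
        \<partial>cube_measure (\<Union>(set Cs)))" for s and M :: nat and Cs :: "nat set list"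
  define N where "N n = (\<integral>\<^sup>+ x. ennreal (norm (star_kernel (of_nat n) (block_products Bs x)))
      \<partial>cube_measure (\<Union>(set Bs)))" for n :: nat
  obtain C where C: "C \<ge> 0" "\<And>s M. Re s > 0 \<Longrightarrow> E s M Bs \<le> ennreal (C * norm s / sqrt (real M + 1))"
    using Cons okBs unfolding E_def by auto
  obtain c where c: "c \<ge> 0" "\<And>n. N (Suc n) \<le> ennreal (c * sqrt (real (Suc n)))"
    using nn_integral_star_kernel_nat[OF okBs] unfolding N_def by auto
  define K where "K = C + 2 * c * (real k * 2 ^ k)"
  have K: "K \<ge> 0" using C c by (simp add: K_def)
  have "E s M (B # Bs) \<le> ennreal (4 * K * norm s / sqrt (real M + 1))" if s: "Re s > 0" for s M
  proof -
    \<comment> \<open>The two parts of the increment from \<open>m + M\<close> to its successor: \<open>p\<close> carries the shift by \<open>s\<close> in the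
        remaining blocks, \<open>q\<close> the shift in the power of the first block product.\<close>
    define p where "p m x = ennreal ((\<Prod>i\<in>B. x i) powr real (m + M)) *
        ennreal (norm (star_kernel (s + of_nat (Suc (m + M))) (block_products Bs x) -
          star_kernel (of_nat (Suc (m + M))) (block_products Bs x)))" for m :: nat and x :: "nat \<Rightarrow> real"
    define q where "q m x = ennreal ((\<Prod>i\<in>B. x i) powr (real (m + M) - 1/2) - (\<Prod>i\<in>B. x i) powr real (m + M)) *
        ennreal (norm (star_kernel (of_nat (Suc (m + M))) (block_products Bs x)))" for m :: nat and x :: "nat \<Rightarrow> real"
    have [measurable]: "p m \<in> borel_measurable (cube_measure (\<Union>(set (B # Bs))))"
      "q m \<in> borel_measurable (cube_measure (\<Union>(set (B # Bs))))" for m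
      unfolding p_def q_def by measurable
    have "AE x in cube_measure (\<Union>(set (B # Bs))).
      ennreal (norm (star_kernel (s + of_nat M) (block_products (B # Bs) x) - star_kernel (of_nat M) (block_products (B # Bs) x)))
      \<le> (\<Sum>m. p m x + ennreal (2 * norm s) * q m x)"
      using AE_block_products[OF ok]
    proof (rule AE_mp, intro AE_I2 impI)
      fix x assume x: "set (block_products (B # Bs) x) \<subseteq> {0<..<1}"
      define z where "z = (\<Prod>i\<in>B. x i)"
      define zs where "zs = block_products Bs x"
      have zzs: "block_products (B # Bs) x = z # zs" by (simp add: z_def zs_def)
      have xz: "set (z # zs) \<subseteq> {0<..<1}" using x zzs by simp
      have z: "0 < z" "z < 1" using xz by auto
      let ?f = "\<lambda>M. star_kernel (s + of_nat M) (z # zs) - star_kernel (of_nat M) (z # zs)"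
      let ?g = "\<lambda>M. star_kernel (s + of_nat M) zs - star_kernel (of_nat M) zs"
      have "ennreal (norm (?f M)) \<le> (\<Sum>m. ennreal (norm (?f (Suc (m + M)) - ?f (m + M))))"
        by (intro norm_le_suminf_differences star_kernel_diff_tendsto_0 xz)
      also have "\<dots> \<le> (\<Sum>m. p m x + ennreal (2 * norm s) * q m x)"
      proof (intro suminf_le summableI)
        fix m
        define n where "n = m + M"
        have "?f (Suc n) - ?f n = of_real z powr (s + of_nat n) * star_kernel (s + of_nat (Suc n)) zs
            - of_real z powr of_nat n * star_kernel (of_nat (Suc n)) zs"
          using star_kernel_Suc[OF xz, of "s + of_nat n"] star_kernel_Suc[OF xz, of "of_nat n"]
          by (simp add: algebra_simps)
        also have "\<dots> = of_real z powr (s + of_nat n) * ?g (Suc n)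
            + (of_real z powr (s + of_nat n) - of_real z powr of_nat n) * star_kernel (of_nat (Suc n)) zs"
          by (simp add: algebra_simps)
        finally have "norm (?f (Suc n) - ?f n) \<le> norm (complex_of_real z powr (s + of_nat n)) * norm (?g (Suc n))
            + norm (complex_of_real z powr (s + of_nat n) - of_real z powr of_nat n) * norm (star_kernel (of_nat (Suc n)) zs)"
          by (metis norm_mult norm_triangle_ineq)
        also have "norm (complex_of_real z powr (s + of_nat n)) \<le> z powr real n"
          using z s by (simp add: norm_powr_real_powr powr_mono')
        also have "norm (complex_of_real z powr (s + of_nat n) - of_real z powr of_nat n) \<le>
            2 * norm s * (z powr (real n - 1/2) - z powr real n)"
          using z s by (intro norm_powr_diff_le) auto
        finally have le: "norm (?f (Suc n) - ?f n) \<le> z powr real n * norm (?g (Suc n)) +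
            2 * norm s * (z powr (real n - 1/2) - z powr real n) * norm (star_kernel (of_nat (Suc n)) zs)"
          by (simp add: mult_right_mono)
        have "0 \<le> z powr (real n - 1/2) - z powr real n" using z by (simp add: powr_mono')
        then have "p m x + ennreal (2 * norm s) * q m x = ennreal (z powr real n * norm (?g (Suc n)) +
            2 * norm s * (z powr (real n - 1/2) - z powr real n) * norm (star_kernel (of_nat (Suc n)) zs))"
          unfolding p_def q_def z_def[symmetric] zs_def[symmetric] n_def[symmetric]
          by (subst ennreal_plus) (simp_all add: ennreal_mult mult.assoc)
        with le show "ennreal (norm (?f (Suc (m + M)) - ?f (m + M))) \<le> p m x + ennreal (2 * norm s) * q m x"
          unfolding n_def by (simp only: ennreal_leI)
      qed
      finally show "ennreal (norm (star_kernel (s + of_nat M) (block_products (B # Bs) x) - star_kernel (of_nat M) (block_products (B # Bs) x)))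
        \<le> (\<Sum>m. p m x + ennreal (2 * norm s) * q m x)" unfolding zzs .
    qed
    then have "E s M (B # Bs) \<le> (\<integral>\<^sup>+ x. (\<Sum>m. p m x + ennreal (2 * norm s) * q m x) \<partial>cube_measure (\<Union>(set (B # Bs))))"
      unfolding E_def by (rule nn_integral_mono_AE)
    also have "\<dots> = (\<Sum>m. (\<integral>\<^sup>+ x. p m x \<partial>cube_measure (\<Union>(set (B # Bs)))) +
        ennreal (2 * norm s) * (\<integral>\<^sup>+ x. q m x \<partial>cube_measure (\<Union>(set (B # Bs)))))"
      by (subst nn_integral_suminf) (simp_all add: nn_integral_add nn_integral_cmult del: Union_insert set_simps)
    also have "\<dots> \<le> (\<Sum>m. ennreal (K * norm s) * ennreal (1 / (real (m + M + 1) * sqrt (real (m + M + 1)))))"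
    proof (intro suminf_le summableI)
      fix m
      define n where "n = m + M"
      define r where "r = real n + 1"
      have r: "r \<ge> 1" "r > 0" by (auto simp: r_def)
      have "(\<integral>\<^sup>+ x. p m x \<partial>cube_measure (\<Union>(set (B # Bs)))) = ennreal (1 / r ^ k) * E s (Suc n) Bs"
        unfolding E_def p_def n_def[symmetric]
        by (subst nn_integral_split_block[OF ok, where g = "\<lambda>z. ennreal (z powr real n)"
            and H = "\<lambda>v. ennreal (norm (star_kernel (s + of_nat (Suc n)) v - star_kernel (of_nat (Suc n)) v))"])
          (auto simp: nn_integral_block_powr[OF B] k_def r_def)
      also have "\<dots> \<le> ennreal (1 / r) * ennreal (C * norm s / sqrt r)"
      proof (intro mult_mono ennreal_leI)
        have "r ^ 1 \<le> r ^ k" using k r by (intro power_increasing) auto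
        then show "1 / r ^ k \<le> 1 / r" using r by (intro divide_left_mono) auto
        have "E s (Suc n) Bs \<le> ennreal (C * norm s / sqrt (real (Suc n) + 1))" by (rule C(2)[OF s])
        also have "\<dots> \<le> ennreal (C * norm s / sqrt r)"
          using C(1) r by (intro ennreal_leI divide_left_mono) (auto simp: r_def)
        finally show "E s (Suc n) Bs \<le> ennreal (C * norm s / sqrt r)" .
      qed auto
      also have "\<dots> = ennreal (C * norm s / (r * sqrt r))"
        using C(1) r by (simp add: ennreal_mult[symmetric])
      finally have p: "(\<integral>\<^sup>+ x. p m x \<partial>cube_measure (\<Union>(set (B # Bs)))) \<le> ennreal (C * norm s / (r * sqrt r))" .
      have "(\<integral>\<^sup>+ x. q m x \<partial>cube_measure (\<Union>(set (B # Bs)))) = ennreal (1 / (r - 1/2) ^ k - 1 / r ^ k) * N (Suc n)"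
        unfolding N_def q_def n_def[symmetric]
        by (subst nn_integral_split_block[OF ok, where g = "\<lambda>z. ennreal (z powr (real n - 1/2) - z powr real n)"
            and H = "\<lambda>v. ennreal (norm (star_kernel (of_nat (Suc n)) v))"])
          (auto simp: nn_integral_block_powr_diff[OF B, of "real n"] k_def r_def add.commute[of "1/2"])
      also have "\<dots> \<le> ennreal (real k * 2 ^ k / r\<^sup>2) * ennreal (c * sqrt r)"
        using c(2)[of n] inverse_power_diff_le[OF r(1) k]
        by (intro mult_mono ennreal_leI) (auto simp: r_def add.commute)
      also have "\<dots> = ennreal (c * (real k * 2 ^ k) / (r * sqrt r))"
      proof -
        have "sqrt r / r\<^sup>2 = 1 / (r * sqrt r)" using r by (simp add: field_simps power2_eq_square)
        then have "real k * 2 ^ k / r\<^sup>2 * (c * sqrt r) = c * (real k * 2 ^ k) / (r * sqrt r)"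
          by (metis (no_types, opaque_lifting) mult.commute mult.left_commute mult_1 times_divide_eq_left times_divide_eq_right)
        then show ?thesis using c(1) r by (simp add: ennreal_mult[symmetric])
      qed
      finally have q: "(\<integral>\<^sup>+ x. q m x \<partial>cube_measure (\<Union>(set (B # Bs)))) \<le> ennreal (c * (real k * 2 ^ k) / (r * sqrt r))" .
      have "(\<integral>\<^sup>+ x. p m x \<partial>cube_measure (\<Union>(set (B # Bs)))) +
          ennreal (2 * norm s) * (\<integral>\<^sup>+ x. q m x \<partial>cube_measure (\<Union>(set (B # Bs))))
        \<le> ennreal (C * norm s / (r * sqrt r)) + ennreal (2 * norm s) * ennreal (c * (real k * 2 ^ k) / (r * sqrt r))"
        using p q by (intro add_mono mult_left_mono) auto
      also have "\<dots> = ennreal (C * norm s / (r * sqrt r) + 2 * norm s * (c * (real k * 2 ^ k) / (r * sqrt r)))"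
        using C(1) c(1) r by (simp add: ennreal_mult[symmetric] ennreal_plus[symmetric] del: ennreal_plus)
      also have "C * norm s / (r * sqrt r) + 2 * norm s * (c * (real k * 2 ^ k) / (r * sqrt r)) = K * norm s * (1 / (r * sqrt r))"
        using r by (simp add: K_def field_simps)
      also have "ennreal (K * norm s * (1 / (r * sqrt r))) = ennreal (K * norm s) * ennreal (1 / (r * sqrt r))"
        using K r by (subst ennreal_mult) auto
      also have "r = real (m + M + 1)" by (simp add: r_def n_def)
      finally show "(\<integral>\<^sup>+ x. p m x \<partial>cube_measure (\<Union>(set (B # Bs)))) +
          ennreal (2 * norm s) * (\<integral>\<^sup>+ x. q m x \<partial>cube_measure (\<Union>(set (B # Bs))))
        \<le> ennreal (K * norm s) * ennreal (1 / (real (m + M + 1) * sqrt (real (m + M + 1))))" .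
    qed
    also have "\<dots> = ennreal (K * norm s) * (\<Sum>m. ennreal (1 / (real (m + M + 1) * sqrt (real (m + M + 1)))))"
      by simp
    also have "\<dots> \<le> ennreal (K * norm s) * ennreal (4 / sqrt (real M + 1))"
      by (intro mult_left_mono suminf_three_halves_le) auto
    also have "\<dots> = ennreal (4 * K * norm s / sqrt (real M + 1))"
      using K by (simp add: ennreal_mult[symmetric] mult_ac)
    finally show ?thesis .
  qed
  then show ?case using K unfolding E_def by (intro exI[of _ "4 * K"]) auto
qed

section \<open>The difference equation and its iteration\<close>

definition star_integral :: "complex \<Rightarrow> nat set list \<Rightarrow> complex" where
  "star_integral s Bs = (\<integral>x. star_kernel s (block_products Bs x) \<partial>cube_measure (\<Union>(set Bs)))"

lemma AE_star_kernel_0: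
  assumes "disjoint_blocks Bs" "Bs \<noteq> []"
  shows "AE x in cube_measure (\<Union>(set Bs)). star_kernel 0 (block_products Bs x) = 0"
  using AE_block_products[OF assms(1)]
proof (rule AE_mp, intro AE_I2 impI)
  fix x assume "set (block_products Bs x) \<subseteq> {0<..<1}"
  then show "star_kernel 0 (block_products Bs x) = 0"
    using assms(2) by (intro star_kernel_0) (auto simp: block_products_def)
qed

lemma star_integral_Nil [simp]: "star_integral s [] = 1"
  by (simp add: star_integral_def measure_def space_PiM_empty)

lemma star_integral_0:
  assumes "disjoint_blocks Bs" "Bs \<noteq> []"
  shows "star_integral 0 Bs = 0"
proof -
  have "star_integral 0 Bs = (\<integral>x. 0 \<partial>cube_measure (\<Union>(set Bs)))"
    unfolding star_integral_def using AE_star_kernel_0[OF assms] by (intro integral_cong_AE) simp_all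
  then show ?thesis by simp
qed

lemma integrable_star_kernel:
  assumes ok: "disjoint_blocks Bs" and s: "Re s > 0 \<or> s = 0"
  shows "integrable (cube_measure (\<Union>(set Bs))) (\<lambda>x. star_kernel s (block_products Bs x))"
proof (cases "Bs = []")
  case True
  then show ?thesis by (auto intro!: integrableI_bounded simp: space_PiM_empty)
next
  case False
  note AE0 = AE_star_kernel_0[OF ok False]
  show ?thesis
  proof (cases "s = 0")
    case True
    have "integrable (cube_measure (\<Union>(set Bs))) (\<lambda>x. 0 :: complex)" by simp
    then show ?thesis
      using AE0 True by (subst integrable_cong_AE[where g = "\<lambda>_. 0"]) simp_all
  next
    case False
    with s have "Re s > 0" by simp
    then obtain C where "(\<integral>\<^sup>+ x. ennreal (norm (star_kernel (s + of_nat 0) (block_products Bs x) - star_kernel (of_nat 0) (block_products Bs x)))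
        \<partial>cube_measure (\<Union>(set Bs))) \<le> ennreal (C * norm s / sqrt (real 0 + 1))"
      using nn_integral_star_kernel_shift[OF ok] by blast
    moreover have "(\<integral>\<^sup>+ x. ennreal (norm (star_kernel (s + of_nat 0) (block_products Bs x) - star_kernel (of_nat 0) (block_products Bs x)))
        \<partial>cube_measure (\<Union>(set Bs))) = (\<integral>\<^sup>+ x. ennreal (norm (star_kernel s (block_products Bs x))) \<partial>cube_measure (\<Union>(set Bs)))"
      using AE0 by (intro nn_integral_cong_AE) auto
    ultimately have "(\<integral>\<^sup>+ x. ennreal (norm (star_kernel s (block_products Bs x))) \<partial>cube_measure (\<Union>(set Bs))) < \<infinity>"
      by (metis ennreal_less_top infinity_ennreal_def order.strict_trans1)
    then show ?thesis by (intro integrableI_bounded) simp_all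
  qed
qed

text \<open>The case \<open>s = 0\<close> is admitted so that the iteration can start from the vanishing integral there.\<close>

lemma star_integral_step:
  assumes ok: "disjoint_blocks (B # Bs)" and s: "Re s > 0 \<or> s = 0"
  shows "star_integral (s + 1) (B # Bs) =
    star_integral s (B # Bs) + star_integral (s + 1) Bs / (s + 1) ^ card B"
proof -
  let ?M = "cube_measure (\<Union>(set (B # Bs)))"
  let ?f = "\<lambda>x. complex_of_real (\<Prod>i\<in>B. x i) powr s * star_kernel (s + 1) (block_products Bs x)"
  have okBs: "disjoint_blocks Bs" using ok by simp
  have f: "has_bochner_integral ?M ?f (1 / (s + 1) ^ card B * star_integral (s + 1) Bs)"
    unfolding star_integral_def using s
    by (intro integral_split_block ok integrable_star_kernel okBs) auto
  have g: "integrable ?M (\<lambda>x. star_kernel s (block_products (B # Bs) x))"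
    by (rule integrable_star_kernel[OF ok s])
  have "star_integral (s + 1) (B # Bs) =
      (\<integral>x. star_kernel s (block_products (B # Bs) x) + ?f x \<partial>?M)"
    unfolding star_integral_def
  proof (rule integral_cong_AE)
    show "(\<lambda>x. star_kernel (s + 1) (block_products (B # Bs) x)) \<in> borel_measurable ?M"
      by (rule measurable_star_kernel) simp
    show "(\<lambda>x. star_kernel s (block_products (B # Bs) x) + ?f x) \<in> borel_measurable ?M"
      using g borel_measurable_has_bochner_integral[OF f] by (intro borel_measurable_add) auto
    show "AE x in ?M. star_kernel (s + 1) (block_products (B # Bs) x) =
        star_kernel s (block_products (B # Bs) x) + ?f x"
      using AE_block_products[OF ok]
    proof (rule AE_mp, intro AE_I2 impI)
      fix x assume "set (block_products (B # Bs) x) \<subseteq> {0<..<1}"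
      then show "star_kernel (s + 1) (block_products (B # Bs) x) =
        star_kernel s (block_products (B # Bs) x) + ?f x"
        unfolding block_products_simps by (rule star_kernel_Suc)
    qed
  qed
  also have "\<dots> = star_integral s (B # Bs) + 1 / (s + 1) ^ card B * star_integral (s + 1) Bs"
    using f g unfolding star_integral_def[of s "B # Bs"]
    by (subst Bochner_Integration.integral_add) (auto simp: has_bochner_integral_iff)
  finally show ?thesis by simp
qed

lemma star_integral_shift_bound:
  assumes ok: "disjoint_blocks Bs"
  shows "\<exists>C\<ge>0. \<forall>s M. Re s > 0 \<longrightarrow>
    norm (star_integral (s + of_nat M) Bs - star_integral (of_nat M) Bs) \<le> C * norm s / sqrt (real M + 1)"
proof -
  let ?M = "cube_measure (\<Union>(set Bs))"
  obtain C where C: "C \<ge> 0" and bound: "\<And>s M. Re s > 0 \<Longrightarrow>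
      (\<integral>\<^sup>+ x. ennreal (norm (star_kernel (s + of_nat M) (block_products Bs x) - star_kernel (of_nat M) (block_products Bs x)))
        \<partial>?M) \<le> ennreal (C * norm s / sqrt (real M + 1))"
    using nn_integral_star_kernel_shift[OF ok] by blast
  have "norm (star_integral (s + of_nat M) Bs - star_integral (of_nat M) Bs) \<le> C * norm s / sqrt (real M + 1)"
    if s: "Re s > 0" for s and M :: nat
  proof -
    have int: "integrable ?M (\<lambda>x. star_kernel (s + of_nat M) (block_products Bs x))"
      "integrable ?M (\<lambda>x. star_kernel (of_nat M) (block_products Bs x))"
      using s by (auto intro!: integrable_star_kernel ok)
    let ?d = "\<lambda>x. star_kernel (s + of_nat M) (block_products Bs x) - star_kernel (of_nat M) (block_products Bs x)"
    have "ennreal (norm (\<integral>x. ?d x \<partial>?M)) \<le> (\<integral>\<^sup>+ x. ennreal (norm (?d x)) \<partial>?M)"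
      using int by (intro integral_norm_bound_ennreal) auto
    also have "\<dots> \<le> ennreal (C * norm s / sqrt (real M + 1))" by (rule bound[OF s])
    finally have "norm (\<integral>x. ?d x \<partial>?M) \<le> C * norm s / sqrt (real M + 1)"
      using C by (subst (asm) ennreal_le_iff) auto
    then show ?thesis using int by (simp add: star_integral_def)
  qed
  then show ?thesis using C by blast
qed

lemma finite_star_tuples: "finite (star_tuples M r)"
  by (rule finite_subset[OF _ finite_lists_length_eq[of "{1..M}" r]]) (auto simp: star_tuples_def)

lemma star_tuples_0_Suc: "star_tuples 0 (Suc r) = {}"
  by (auto simp: star_tuples_def length_Suc_conv)

lemma star_tuples_0_right: "star_tuples M 0 = {[]}"
  by (auto simp: star_tuples_def)

text \<open>Splits by whether the largest entry attains the upper bound \<open>Suc M\<close>.\<close>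

lemma star_tuples_Suc_Suc:
  "star_tuples (Suc M) (Suc r) = star_tuples M (Suc r) \<union> (#) (Suc M) ` star_tuples (Suc M) r"
proof (intro equalityI subsetI)
  fix ms assume ms: "ms \<in> star_tuples (Suc M) (Suc r)"
  then obtain m ms' where [simp]: "ms = m # ms'" by (auto simp: star_tuples_def length_Suc_conv)
  show "ms \<in> star_tuples M (Suc r) \<union> (#) (Suc M) ` star_tuples (Suc M) r"
  proof (cases "m = Suc M")
    case True
    then show ?thesis using ms by (auto simp: star_tuples_def)
  next
    case False
    then have "m \<le> M" using ms by (auto simp: star_tuples_def)
    then show ?thesis using ms by (force simp: star_tuples_def)
  qed
qed (force simp: star_tuples_def)+

lemma G_fin_Nil: "G_fin M s [] = 1"
  by (simp add: G_fin_def star_tuples_0_right)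

lemma G_fin_0_Cons: "G_fin 0 s (k # ks) = 0"
  by (simp add: G_fin_def star_tuples_0_Suc)

lemma G_fin_Suc_Cons:
  "G_fin (Suc M) s (k # ks) = G_fin M s (k # ks) + G_fin (Suc M) s ks / (of_nat (Suc M) + s) ^ k"
proof -
  let ?f = "\<lambda>ks ms. 1 / (\<Prod>j<length ks. (of_nat (ms ! j) + s) ^ (ks ! j))"
  have disj: "star_tuples M (Suc (length ks)) \<inter> (#) (Suc M) ` star_tuples (Suc M) (length ks) = {}"
    by (auto simp: star_tuples_def)
  have "G_fin (Suc M) s (k # ks) = G_fin M s (k # ks) +
      (\<Sum>ms\<in>(#) (Suc M) ` star_tuples (Suc M) (length ks). ?f (k # ks) ms)"
    unfolding G_fin_def list.size add_0_right add_Suc_right star_tuples_Suc_Suc using disj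
    by (intro sum.union_disjoint) (auto simp: finite_star_tuples)
  also have "(\<Sum>ms\<in>(#) (Suc M) ` star_tuples (Suc M) (length ks). ?f (k # ks) ms) =
      (\<Sum>ms\<in>star_tuples (Suc M) (length ks). ?f ks ms / (of_nat (Suc M) + s) ^ k)"
    by (subst sum.reindex)
      (auto simp: prod.lessThan_Suc_shift mult.commute simp del: prod.lessThan_Suc of_nat_Suc)
  also have "\<dots> = G_fin (Suc M) s ks / (of_nat (Suc M) + s) ^ k"
    by (simp add: G_fin_def sum_divide_distrib)
  finally show ?thesis .
qed

text \<open>The expansion below therefore covers the finite sums of both kinds.\<close>

lemma H_fin_eq_G_fin: "H_fin M ks = G_fin M 0 ks"
  by (simp add: H_fin_def G_fin_def)

text \<open>Both sides agree for \<open>M = 0\<close>, where only \<open>j = 0\<close> contributes, and have the same increment in \<open>M\<close>: on the right,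
\<open>G_fin_Suc_Cons\<close> turns it into the expansion for the remaining blocks.\<close>

lemma star_integral_expansion:
  assumes "disjoint_blocks Bs" and s: "Re s > 0 \<or> s = 0"
  shows "star_integral (s + of_nat M) Bs =
    (\<Sum>j\<le>length Bs. G_fin M s (take j (map card Bs)) * star_integral s (drop j Bs))"
  using assms(1)
proof (induction Bs arbitrary: M)
  case Nil
  then show ?case by (simp add: G_fin_Nil)
next
  case (Cons B Bs)
  note ok = Cons.prems
  show ?case
  proof (induction M)
    case 0
    have "(\<Sum>j\<le>length (B # Bs). G_fin 0 s (take j (map card (B # Bs))) * star_integral s (drop j (B # Bs))) =
      star_integral s (B # Bs)"
      by (simp add: sum.atMost_Suc_shift G_fin_0_Cons G_fin_Nil del: sum.atMost_Suc)
    then show ?case by simp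
  next
    case (Suc M)
    let ?S = "\<lambda>M Bs. \<Sum>j\<le>length Bs. G_fin M s (take j (map card Bs)) * star_integral s (drop j Bs)"
    have split: "?S m (B # Bs) = star_integral s (B # Bs) +
       (\<Sum>j\<le>length Bs. G_fin m s (card B # take j (map card Bs)) * star_integral s (drop j Bs))" for m
      by (simp add: sum.atMost_Suc_shift G_fin_Nil del: sum.atMost_Suc)
    have "Re (s + of_nat M) > 0 \<or> s + of_nat M = 0" using s by auto
    then have "star_integral (s + of_nat (Suc M)) (B # Bs) = star_integral (s + of_nat M) (B # Bs) +
        star_integral (s + of_nat (Suc M)) Bs / (of_nat (Suc M) + s) ^ card B"
      using star_integral_step[OF ok, of "s + of_nat M"] by (simp add: ac_simps)
    also have "\<dots> = ?S M (B # Bs) + ?S (Suc M) Bs / (of_nat (Suc M) + s) ^ card B"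
      using Suc Cons.IH[of "Suc M"] ok by (simp only: disjoint_blocks.simps)
    also have "\<dots> = ?S (Suc M) (B # Bs)"
      unfolding split by (simp only: G_fin_Suc_Cons distrib_right sum.distrib
        sum_divide_distrib times_divide_eq_left add.assoc)
    finally show ?case .
  qed
qed

lemma star_integral_of_nat:
  assumes "disjoint_blocks Bs"
  shows "star_integral (of_nat M) Bs = H_fin M (map card Bs)"
proof -
  have "star_integral (of_nat M) Bs =
      (\<Sum>j\<le>length Bs. G_fin M 0 (take j (map card Bs)) * star_integral 0 (drop j Bs))"
    using star_integral_expansion[OF assms, of 0 M] by simp
  also have "\<dots> = (\<Sum>j\<le>length Bs. if j = length Bs then G_fin M 0 (map card Bs) else 0)"
    using star_integral_0[OF disjoint_blocks_drop[OF assms]] by (intro sum.cong) auto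
  finally show ?thesis by (simp add: H_fin_eq_G_fin)
qed

section \<open>Convergence and analyticity\<close>

text \<open>Moving the term \<open>j = 0\<close> of the expansion to the other side, the subtracted sum is $F_{s+M}-F_s$, while the finite
sum $H_M^\star$ is $F_M$.\<close>

lemma H_star_seq_eq:
  assumes ok: "disjoint_blocks Bs" and s: "Re s > 0"
    and IH: "\<And>j. 1 \<le> j \<Longrightarrow> j \<le> length Bs \<Longrightarrow> H_star s (map card (drop j Bs)) = star_integral s (drop j Bs)"
  shows "H_star_seq s (map card Bs) M =
    star_integral s Bs - (star_integral (s + of_nat M) Bs - star_integral (of_nat M) Bs)"
proof -
  let ?g = "\<lambda>j. G_fin M s (take j (map card Bs)) * star_integral s (drop j Bs)"
  have "star_integral (s + of_nat M) Bs = (\<Sum>j\<in>insert 0 {1..length Bs}. ?g j)"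
    using star_integral_expansion[OF ok, of s M] s
    by (simp add: atMost_atLeast0 atLeastAtMost_insertL[symmetric])
  also have "\<dots> = star_integral s Bs + (\<Sum>j=1..length Bs. ?g j)"
    by (subst sum.insert) (auto simp: G_fin_Nil)
  finally show ?thesis
    using IH by (simp add: H_star_seq_def star_integral_of_nat[OF ok] drop_map)
qed

lemma divide_sqrt_tendsto_0: "(\<lambda>M. C / sqrt (real M + 1)) \<longlonglongrightarrow> 0"
  by real_asymp

text \<open>Limit and value are established together: the sequence for a list contains the values for its suffixes.\<close>

lemma H_star_seq_tendsto:
  assumes "disjoint_blocks Bs" "Re s > 0"
  shows "H_star_seq s (map card Bs) \<longlonglongrightarrow> star_integral s Bs \<and> H_star s (map card Bs) = star_integral s Bs"
  using assms(1)
proof (induction Bs rule: length_induct)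
  case (1 Bs)
  note ok = 1(2)
  have eq: "H_star_seq s (map card Bs) M =
      star_integral s Bs - (star_integral (s + of_nat M) Bs - star_integral (of_nat M) Bs)" for M
    using 1 by (intro H_star_seq_eq assms(2)) (auto simp: disjoint_blocks_drop)
  obtain C where C: "\<And>M. norm (star_integral (s + of_nat M) Bs - star_integral (of_nat M) Bs) \<le> C * norm s / sqrt (real M + 1)"
    using star_integral_shift_bound[OF ok] assms(2) by blast
  have "(\<lambda>M. star_integral (s + of_nat M) Bs - star_integral (of_nat M) Bs) \<longlonglongrightarrow> 0"
    using C divide_sqrt_tendsto_0 by (rule Lim_null_comparison[OF always_eventually, OF allI])
  then have "(\<lambda>M. star_integral s Bs - (star_integral (s + of_nat M) Bs - star_integral (of_nat M) Bs)) \<longlonglongrightarrow> star_integral s Bs - 0"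
    by (intro tendsto_diff tendsto_const)
  then have lim: "H_star_seq s (map card Bs) \<longlonglongrightarrow> star_integral s Bs"
    unfolding eq[abs_def] by simp
  then have "H_star s (map card Bs) = star_integral s Bs"
    by (cases "Bs = []") (simp_all add: H_star_Nil H_star_eq_lim limI)
  with lim show ?case by simp
qed

lemmas H_star_eq_star_integral = H_star_seq_tendsto[THEN conjunct2]

lemma holomorphic_G_fin: "(\<lambda>s. G_fin M s ks) holomorphic_on {s. Re s > 0}"
proof (induction ks arbitrary: M)
  case (Cons k ks)
  show ?case
  proof (induction M)
    case (Suc M)
    have "of_nat (Suc M) + s \<noteq> 0" if "Re s > 0" for s
      using that by (auto simp: complex_eq_iff)
    then show ?case
      unfolding G_fin_Suc_Cons using Suc Cons.IH[of "Suc M"]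
      by (intro holomorphic_intros) auto
  qed (simp add: G_fin_0_Cons)
qed (simp add: G_fin_Nil)

text \<open>The approximants are combinations of rational functions with integrals over fewer blocks, and the distance
$C\,|s|/\sqrt{M+1}$ is uniform on compact sets.\<close>

lemma holomorphic_star_integral:
  assumes "disjoint_blocks Bs"
  shows "(\<lambda>s. star_integral s Bs) holomorphic_on {s. Re s > 0}"
  using assms
proof (induction Bs rule: length_induct)
  case (1 Bs)
  note ok = 1(2)
  obtain C where C: "C \<ge> 0" "\<And>s M. Re s > 0 \<Longrightarrow> 
      norm (star_integral (s + of_nat M) Bs - star_integral (of_nat M) Bs) \<le> C * norm s / sqrt (real M + 1)"
    using star_integral_shift_bound[OF ok] by blast
  define f where "f M s = H_fin M (map card Bs) -
      (\<Sum>j=1..length Bs. G_fin M s (take j (map card Bs)) * star_integral s (drop j Bs))" for M s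
  have f: "f M s = star_integral s Bs - (star_integral (s + of_nat M) Bs - star_integral (of_nat M) Bs)"
    if "Re s > 0" for M s
    using H_star_seq_eq[OF ok that, of M] H_star_eq_star_integral[OF disjoint_blocks_drop[OF ok] that]
    by (simp add: H_star_seq_def f_def drop_map)
  show ?case
  proof (rule holomorphic_uniform_sequence)
    show "open {s. Re s > 0}" by (rule open_halfspace_Re_gt)
    show "f M holomorphic_on {s. Re s > 0}" for M
      unfolding f_def using 1 by (intro holomorphic_intros holomorphic_G_fin) (auto simp: disjoint_blocks_drop)
    fix s :: complex assume s: "s \<in> {s. Re s > 0}"
    then obtain d where d: "d > 0" "cball s d \<subseteq> {s. Re s > 0}"
      using open_contains_cball_eq[OF open_halfspace_Re_gt[of 0]] by blast
    have "uniform_limit (cball s d) f (\<lambda>s. star_integral s Bs) sequentially"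
    proof (rule uniform_limitI)
      fix e :: real assume "e > 0"
      have "eventually (\<lambda>M. C * (norm s + d) / sqrt (real M + 1) < e) sequentially"
        using divide_sqrt_tendsto_0 \<open>e > 0\<close> by (rule order_tendstoD)
      then show "\<forall>\<^sub>F M in sequentially. \<forall>w\<in>cball s d. dist (f M w) (star_integral w Bs) < e"
      proof (rule eventually_mono, intro ballI)
        fix M w assume e: "C * (norm s + d) / sqrt (real M + 1) < e" and w: "w \<in> cball s d"
        then have "Re w > 0" using d by auto
        then have "dist (f M w) (star_integral w Bs) \<le> C * norm w / sqrt (real M + 1)"
          using C(2)[of w M] by (simp add: f dist_norm norm_minus_commute)
        also have "norm w \<le> norm s + d"
          using w norm_triangle_ineq[of s "w - s"] by (simp add: dist_norm norm_minus_commute)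
        then have "C * norm w / sqrt (real M + 1) \<le> C * (norm s + d) / sqrt (real M + 1)"
          using C(1) by (intro divide_right_mono mult_left_mono) auto
        finally show "dist (f M w) (star_integral w Bs) < e" using e by simp
      qed
    qed
    then show "\<exists>d>0. cball s d \<subseteq> {s. Re s > 0} \<and> uniform_limit (cball s d) f (\<lambda>s. star_integral s Bs) sequentially"
      using d by blast
  qed
qed

section \<open>Consecutive blocks of variables\<close>

text \<open>The blocks of variable indices of the informal statement. The offset \<open>a\<close> is there for the recursion.\<close>

primrec consecutive_blocks :: "nat \<Rightarrow> nat list \<Rightarrow> nat set list" where
  "consecutive_blocks a [] = []"
| "consecutive_blocks a (k # ks) = {a + 1..a + k} # consecutive_blocks (a + k) ks"

lemma Union_consecutive_blocks: "\<Union>(set (consecutive_blocks a ks)) = {a + 1..a + sum_list ks}"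
  by (induction ks arbitrary: a) auto

lemma map_card_consecutive_blocks: "map card (consecutive_blocks a ks) = ks"
  by (induction ks arbitrary: a) auto

lemma disjoint_consecutive_blocks:
  "\<forall>k\<in>set ks. k \<ge> 1 \<Longrightarrow> disjoint_blocks (consecutive_blocks a ks)"
  by (induction ks arbitrary: a) (auto simp: Union_consecutive_blocks)

lemma nodes_consecutive_blocks:
  "nodes (block_products (consecutive_blocks a ks) x) =
    map (\<lambda>j. \<Prod>i=a + 1..a + sum_list (take j ks). x i) [0..<Suc (length ks)]"
proof (induction ks arbitrary: a)
  case (Cons k ks)
  have upt: "[0..<Suc (length (k # ks))] = 0 # map Suc [0..<Suc (length ks)]"
    by (simp add: map_Suc_upt upt_conv_Cons del: upt_Suc)
  have "(\<Prod>i=a + 1..a + k. x i) * (\<Prod>i=a + k + 1..a + k + n. x i) = (\<Prod>i=a + 1..a + (k + n). x i)" for n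
    using prod.ub_add_nat[of "a + 1" "a + k" x n] by (simp add: add.assoc)
  then show ?case
    unfolding upt consecutive_blocks.simps block_products_simps nodes.simps Cons.IH by simp
qed simp

lemma H_integrand_eq_star_kernel:
  "H_integrand s ks x = star_kernel s (block_products (consecutive_blocks 0 ks) x)"
proof -
  have "length (consecutive_blocks a ks) = length ks" for a
    by (induction ks arbitrary: a) auto
  moreover have "1 # map (X ks x) [1..<length ks + 1] = nodes (block_products (consecutive_blocks 0 ks) x)"
    by (simp add: nodes_consecutive_blocks X_def upt_conv_Cons del: upt_Suc)
  ultimately show ?thesis by (simp only: H_integrand_def star_kernel_def block_products_simps)
qed

lemma set_integral_unit_cube:
  fixes f :: "(nat \<Rightarrow> real) \<Rightarrow> complex"
  assumes f: "integrable (cube_measure {1..d}) f"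
  shows "set_integrable (lborel_pow d) (unit_cube d) f"
    and "set_lebesgue_integral (lborel_pow d) (unit_cube d) f = (\<integral>x. f x \<partial>cube_measure {1..d})"
proof -
  have eq: "cube_measure {1..d} = density (lborel_pow d) (\<lambda>x. ennreal (indicator (unit_cube d) x))"
    by (simp add: cube_measure_eq_density unit_cube_def ennreal_indicator)
  have [measurable]: "unit_cube d \<in> sets (lborel_pow d)"
    unfolding unit_cube_def by (intro sets_PiM_I_finite) auto
  have meas: "f \<in> borel_measurable (lborel_pow d)"
    using borel_measurable_integrable[OF f] unfolding eq by simp
  have ind: "(\<lambda>x. indicator (unit_cube d) x :: real) \<in> borel_measurable (lborel_pow d)"
    by (rule borel_measurable_indicator) fact
  from integrable_density[OF meas ind] show "set_integrable (lborel_pow d) (unit_cube d) f"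
    using f unfolding set_integrable_def eq by simp
  have "(\<integral>x. f x \<partial>density (lborel_pow d) (\<lambda>x. ennreal (indicator (unit_cube d) x))) =
      (\<integral>x. indicator (unit_cube d) x *\<^sub>R f x \<partial>lborel_pow d)"
    by (rule integral_density[OF meas ind]) simp
  then show "set_lebesgue_integral (lborel_pow d) (unit_cube d) f = (\<integral>x. f x \<partial>cube_measure {1..d})"
    unfolding set_lebesgue_integral_def eq by simp
qed

theorem theorem1p2:
  fixes ks :: "nat list"
  assumes "ks \<noteq> []" and "\<forall>k\<in>set ks. k \<ge> 1"
  shows
    "(\<forall>s. Re s > 0 \<longrightarrow> (\<forall>i<length ks. convergent (H_star_seq s (drop i ks)))) \<and>
     (\<lambda>s. H_star s ks) analytic_on {s. Re s > 0} \<and>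
     (\<forall>n\<ge>1. H_star (of_nat n) ks = H_fin n ks) \<and>
     (\<forall>s. Re s > 0 \<longrightarrow>
        set_integrable (lborel_pow (sum_list ks)) (unit_cube (sum_list ks)) (H_integrand s ks) \<and>
        H_star s ks =
          set_lebesgue_integral (lborel_pow (sum_list ks)) (unit_cube (sum_list ks))
            (H_integrand s ks))"
proof -
  define Bs where "Bs = consecutive_blocks 0 ks"
  have ok: "disjoint_blocks Bs" and card: "map card Bs = ks" and Un: "\<Union>(set Bs) = {1..sum_list ks}"
    using assms(2) by (simp_all add: Bs_def disjoint_consecutive_blocks map_card_consecutive_blocks
      Union_consecutive_blocks)
  have H_star: "H_star s ks = star_integral s Bs" if "Re s > 0" for s
    using H_star_eq_star_integral[OF ok that] card by simp
  have "convergent (H_star_seq s (drop i ks))" if "Re s > 0" for s i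
    using H_star_seq_tendsto[OF disjoint_blocks_drop[OF ok] that, of i] card
    by (auto simp: convergent_def drop_map)
  moreover have "(\<lambda>s. H_star s ks) analytic_on {s. Re s > 0}"
    unfolding analytic_on_open[OF open_halfspace_Re_gt]
    by (rule holomorphic_transform[OF holomorphic_star_integral[OF ok]]) (simp add: H_star)
  moreover have "H_star (of_nat n) ks = H_fin n ks" if "n \<ge> 1" for n
    using H_star[of "of_nat n"] star_integral_of_nat[OF ok, of n] card that by simp
  moreover have "set_integrable (lborel_pow (sum_list ks)) (unit_cube (sum_list ks)) (H_integrand s ks) \<and>
        H_star s ks = set_lebesgue_integral (lborel_pow (sum_list ks)) (unit_cube (sum_list ks)) (H_integrand s ks)"
    if s: "Re s > 0" for s
  proof -
    have eq: "H_integrand s ks = (\<lambda>x. star_kernel s (block_products Bs x))"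
      by (simp add: fun_eq_iff H_integrand_eq_star_kernel Bs_def)
    have "integrable (cube_measure {1..sum_list ks}) (H_integrand s ks)"
      using integrable_star_kernel[OF ok, of s] s by (simp add: eq Un)
    from set_integral_unit_cube[OF this] show ?thesis
      using H_star[OF s] by (simp add: star_integral_def eq Un)
  qed
  ultimately show ?thesis by blast
qed

end
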